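(* Let $G$ be a circular interval graph satisfying $\chi_l(G) \geq \Delta(G) \geq 9$. Then $G$ contains a complete subgraph $K_{\Delta(G)}$ on $\Delta(G)$ vertices.
   Context: Graphs are finite and simple. $\Delta(G)$ is the maximum degree and $\chi_l(G)$ the list chromatic number (choice number) of $G$. Given a (finite) set $V$ of points on the unit circle together with a set $C$ of closed intervals on the unit circle, define a graph with vertex set $V$ in which two different vertices are adjacent if and only if they are both contained in some element of $C$. Any graph isomorphic to such a graph is a circular interval graph. *)

theory Defs
  imports Complex_Main "HOL-Library.Ramsey"
begin

text \<open>A graph is a vertex set together with a set of edges, each a two-element set of vertices.\<close>

definition finite_simple_graph :: "'a set \<Rightarrow> 'a set set \<Rightarrow> bool" where
  "finite_simple_graph V E \<longleftrightarrow> finite V \<and> E \<subseteq> [V]\<^bsup>2\<^esup>"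

definition graph_iso :: "('a \<Rightarrow> 'b) \<Rightarrow> 'a set \<Rightarrow> 'a set set \<Rightarrow> 'b set \<Rightarrow> 'b set set \<Rightarrow> bool" where
  "graph_iso f V E W F \<longleftrightarrow>
     bij_betw f V W \<and> (\<forall>u\<in>V. \<forall>v\<in>V. {u, v} \<in> E \<longleftrightarrow> {f u, f v} \<in> F)"

definition degree :: "'a set set \<Rightarrow> 'a \<Rightarrow> nat" where
  "degree E v = card {e \<in> E. v \<in> e}"

text \<open>The supremum of the empty set of natural numbers is 0, so the graph without vertices
  has maximum degree 0.\<close>

definition max_degree :: "'a set \<Rightarrow> 'a set set \<Rightarrow> nat" where
  "max_degree V E = (SUP v\<in>V. degree E v)"

definition proper_colouring :: "'a set set \<Rightarrow> ('a \<Rightarrow> nat) \<Rightarrow> bool" where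
  "proper_colouring E c \<longleftrightarrow> (\<forall>u v. {u, v} \<in> E \<longrightarrow> u \<noteq> v \<longrightarrow> c u \<noteq> c v)"

text \<open>Colours are natural numbers; any finite family of finite lists embeds into them.\<close>

definition choosable :: "'a set \<Rightarrow> 'a set set \<Rightarrow> nat \<Rightarrow> bool" where
  "choosable V E k \<longleftrightarrow>
     (\<forall>L :: 'a \<Rightarrow> nat set. (\<forall>v\<in>V. finite (L v) \<and> card (L v) = k) \<longrightarrow>
        (\<exists>c. proper_colouring E c \<and> (\<forall>v\<in>V. c v \<in> L v)))"

definition list_chromatic_number :: "'a set \<Rightarrow> 'a set set \<Rightarrow> nat" where
  "list_chromatic_number V E = (LEAST k. choosable V E k)"

text \<open>The condition \<open>b < a + 2 * pi\<close> makes the map from the real interval injective, so that a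
  closed interval on the circle is homeomorphic to \<open>{a..b}\<close>.\<close>

definition closed_circle_interval :: "complex set \<Rightarrow> bool" where
  "closed_circle_interval I \<longleftrightarrow> (\<exists>a b. a \<le> b \<and> b < a + 2 * pi \<and> I = cis ` {a..b})"

definition interval_edges :: "complex set \<Rightarrow> complex set set \<Rightarrow> complex set set" where
  "interval_edges P C = {{x, y} |x y. x \<in> P \<and> y \<in> P \<and> x \<noteq> y \<and> (\<exists>I\<in>C. x \<in> I \<and> y \<in> I)}"

definition circular_interval_graph :: "'a set \<Rightarrow> 'a set set \<Rightarrow> bool" where
  "circular_interval_graph V E \<longleftrightarrow>
     finite_simple_graph V E \<and>
     (\<exists>P C f. finite P \<and> P \<subseteq> {z. norm z = 1} \<and> (\<forall>I\<in>C. closed_circle_interval I) \<and>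
        graph_iso f V E P (interval_edges P C))"

end

theory Submission
  imports Defs
begin

text \<open>
  Write \<open>\<Delta> = k + 1\<close> and suppose that there is no clique on \<open>k + 1\<close> vertices; the graph is coloured
  from lists of size \<open>k\<close>. By induction all degrees are \<open>k\<close> or \<open>k + 1\<close>, so a greedy colouring only
  fails at the last two vertices \<open>u\<close> and \<open>v\<close>, where it lacks one colour at \<open>u\<close> and two colours at
  \<open>v\<close> (one less at vertices of degree \<open>k\<close>). These are gained by colouring first one or two
  nonadjacent pairs of neighbours of \<open>v\<close>: either the two members of a pair can share a colour, or
  their lists are disjoint and one of them can be given a colour that is useless for \<open>v\<close> (and,
  for the first pair, also for \<open>u\<close>).

  The remaining vertices must be coloured in an order in which each has one or two neighbours
  that come later. Going round the circle provides such an order, unless the removed pairs block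
  the way. Starting from a longest clique \<open>{q..q + m}\<close> of consecutive vertices, a case distinction
  on \<open>k - m\<close> and on how far the vertices just outside reach into the clique finds pairs that do not
  block at least one of the two directions. The argument needs that neighbourhoods do not wrap
  around the circle, which holds from \<open>k + 4\<close> vertices on; graphs on at most \<open>k + 3\<close> vertices have
  complements of maximum degree at most 2 and are treated directly by the same greedy colouring.
\<close>

section \<open>Greedy list colouring after colouring nonadjacent pairs\<close>

text \<open>If \<open>X\<close> and \<open>Y\<close> are disjoint and every choice fails, then
  \<open>X \<times> Y\<close> is covered by \<open>A \<times> A\<close> and
  \<open>B \<times> B\<close>, so \<open>X \<subseteq> A\<close> or \<open>Y \<subseteq> B\<close>.
  As all four sets have size \<open>k\<close>, the inclusion is an equality; hence the other list
  misses that set, and both lists lie in the remaining one, which equal sizes forbid.\<close>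

lemma pair_colours:
  fixes X Y A B :: "'c set"
  assumes "finite X" "finite Y" "finite A" "finite B"
    and c: "card X = k" "card Y = k" "card A = k" "card B = k" and k: "k > 0"
  obtains a b where "a \<in> X" "b \<in> Y" "a = b \<or> a \<notin> A \<or> b \<notin> A" "a = b \<or> a \<notin> B \<or> b \<notin> B"
proof (cases "X \<inter> Y = {}")
  case False
  then show ?thesis using that by blast
next
  case True
  have *: "\<not> (X \<subseteq> C \<and> Y \<subseteq> C)" if "finite C" "card C = k" for C
  proof
    assume "X \<subseteq> C \<and> Y \<subseteq> C"
    then have "X = C" "Y = C" using that c card_subset_eq[of C] by metis+
    then show False using True k that by auto
  qed
  have ne: "X \<noteq> {}" "Y \<noteq> {}" using c k by auto
  have **: "C = X" if "X \<subseteq> C" "card C = k" "finite C" for C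
    using that c card_subset_eq by metis
  have ***: "C = Y" if "Y \<subseteq> C" "card C = k" "finite C" for C
    using that c card_subset_eq by metis
  show ?thesis
  proof (rule ccontr)
    assume "\<not> thesis"
    then have N: "\<And>a b. a \<in> X \<Longrightarrow> b \<in> Y \<Longrightarrow> (a \<in> A \<and> b \<in> A) \<or> (a \<in> B \<and> b \<in> B)"
      using that by blast
    have "X \<subseteq> A \<or> Y \<subseteq> B" using N by blast
    then show False
    proof
      assume "X \<subseteq> A"
      then have "A = X" using ** assms by blast
      then have "Y \<inter> A = {}" using True by blast
      then have "X \<subseteq> B" "Y \<subseteq> B" using N ne by blast+
      then show False using * assms by blast
    next
      assume "Y \<subseteq> B"
      then have "B = Y" using *** assms by blast
      then have "X \<inter> B = {}" using True by blast
      then have "X \<subseteq> A" "Y \<subseteq> A" using N ne by blast+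
      then show False using * assms by blast
    qed
  qed
qed

text \<open>The variant for lists that have already lost colours: only one set \<open>A\<close> has
  to be served, so disjoint lists inside \<open>A\<close> are excluded by counting alone.\<close>

lemma pair_colours_large:
  fixes X Y A :: "'c set"
  assumes "finite X" "finite Y" "finite A" "card A < card X + card Y" "X \<noteq> {}" "Y \<noteq> {}"
  obtains a b where "a \<in> X" "b \<in> Y" "a = b \<or> a \<notin> A \<or> b \<notin> A"
proof (rule ccontr)
  assume "\<not> thesis"
  then have N: "\<And>a b. a \<in> X \<Longrightarrow> b \<in> Y \<Longrightarrow> a \<noteq> b \<and> a \<in> A \<and> b \<in> A"
    using that by blast
  then have "X \<inter> Y = {}" "X \<union> Y \<subseteq> A" using assms by blast+
  then have "card X + card Y \<le> card A"
    using assms by (metis card_Un_disjoint card_mono)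
  then show False using assms by simp
qed

text \<open>If \<open>x\<close> and \<open>y\<close> are neighbours of a vertex with list \<open>X\<close>, then together they forbid at most
  one of its colours.\<close>

definition redundant :: "('a \<Rightarrow> 'c) \<Rightarrow> 'c set \<Rightarrow> 'a \<Rightarrow> 'a \<Rightarrow> bool" where
  "redundant c X x y \<longleftrightarrow> c x = c y \<or> c x \<notin> X \<or> c y \<notin> X"

lemma card_image_redundant:
  assumes "finite A" "x \<in> A" "y \<in> A" "x \<noteq> y" "redundant c X x y"
  shows "card (c ` A \<inter> X) + 1 \<le> card A"
proof -
  obtain z where z: "z \<in> {x, y}" "c z \<in> X \<Longrightarrow> c z \<in> c ` ({x, y} - {z})"
    using assms(4,5) unfolding redundant_def by auto
  have zA: "z \<in> A" using z assms by auto
  have z: "c ` A \<inter> X \<subseteq> c ` (A - {z})"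
  proof
    fix a assume a: "a \<in> c ` A \<inter> X"
    then obtain s where s: "s \<in> A" "a = c s" by auto
    then show "a \<in> c ` (A - {z})" using a z assms(2,3) by (cases "s = z") auto
  qed
  have "card (c ` A \<inter> X) \<le> card (A - {z})"
    using z assms by (meson card_image_le card_mono finite_Diff finite_imageI le_trans)
  then show ?thesis using zA assms(1) card_Suc_Diff1[of A z] by simp
qed

lemma card_image_redundant2:
  assumes "finite A" "x \<in> A" "y \<in> A" "x \<noteq> y" "redundant c X x y"
    and "z \<in> A" "w \<in> A" "z \<noteq> w" "redundant c X z w" "{x, y} \<inter> {z, w} = {}"
  shows "card (c ` A \<inter> X) + 2 \<le> card A"
proof -
  obtain p where p: "p \<in> {x, y}" "c p \<in> X \<Longrightarrow> c p \<in> c ` ({x, y} - {p})"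
    using assms(4,5) unfolding redundant_def by auto
  obtain q where q: "q \<in> {z, w}" "c q \<in> X \<Longrightarrow> c q \<in> c ` ({z, w} - {q})"
    using assms(8,9) unfolding redundant_def by auto
  have "c ` A \<inter> X \<subseteq> c ` (A - {p, q})"
  proof
    fix a assume a: "a \<in> c ` A \<inter> X"
    then obtain s where s: "s \<in> A" "a = c s" by auto
    show "a \<in> c ` (A - {p, q})"
    proof (cases "s = p \<or> s = q")
      case False
      then show ?thesis using s by blast
    next
      case True
      then show ?thesis
      proof
        assume "s = p"
        then show ?thesis using p a s assms(2,3,10) q(1) by auto
      next
        assume "s = q"
        then show ?thesis using q a s assms(6,7,10) p(1) by auto
      qed
    qed
  qed
  then have "card (c ` A \<inter> X) \<le> card (A - {p, q})"
    using assms(1) by (meson card_image_le card_mono finite_Diff finite_imageI le_trans)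
  moreover have "card (A - {p, q}) = card A - 2" "2 \<le> card A"
  proof -
    have pq: "p \<noteq> q" "{p, q} \<subseteq> A" using p q assms by auto
    show "card (A - {p, q}) = card A - 2" using pq assms(1) by (simp add: card_Diff_subset)
    show "2 \<le> card A" using card_mono[OF assms(1) pq(2)] pq(1) by simp
  qed
  ultimately show ?thesis by simp
qed

section \<open>Greedy colouring orders built from the last vertex backwards\<close>

locale list_graph =
  fixes V :: "'a set" and adj :: "'a \<Rightarrow> 'a \<Rightarrow> bool" and L :: "'a \<Rightarrow> 'c set" and k :: nat
  assumes fin: "finite V" and sym: "adj u v \<Longrightarrow> adj v u" and irrefl: "\<not> adj v v"
    and lists: "v \<in> V \<Longrightarrow> finite (L v) \<and> card (L v) = k"
begin

definition N :: "'a \<Rightarrow> 'a set" where "N v = {w \<in> V. adj v w}"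

definition colours :: "('a \<Rightarrow> 'c) \<Rightarrow> 'a set \<Rightarrow> bool" where
  "colours c S \<longleftrightarrow> (\<forall>v\<in>S. c v \<in> L v) \<and> (\<forall>u\<in>S. \<forall>v\<in>S. adj u v \<longrightarrow> c u \<noteq> c v)"

text \<open>The vertices of \<open>P\<close> are coloured first, by \<open>c\<close>, and those of \<open>T\<close> last, whatever colours
  have been given to the vertices in between.\<close>

definition completes :: "('a \<Rightarrow> 'c) \<Rightarrow> 'a set \<Rightarrow> 'a set \<Rightarrow> bool" where
  "completes c P T \<longleftrightarrow>
     (\<forall>c'. (\<forall>v\<in>P. c' v = c v) \<longrightarrow> colours c' (V - T) \<longrightarrow> (\<exists>c''. colours c'' V))"

lemma finN [simp]: "finite (N v)"
  by (simp add: N_def fin)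

lemma completes_empty: "completes c P {}"
  by (auto simp: completes_def)

lemma completes_all:
  assumes "colours c P" "completes c P (V - P)" "P \<subseteq> V"
  shows "\<exists>c. colours c V"
  using assms by (auto simp: completes_def double_diff)

text \<open>The order is built backwards: \<open>w\<close> is coloured immediately before
  \<open>T\<close>, so only its neighbours outside \<open>T\<close> can take a colour from its
  list.\<close>

lemma completes_insert:
  assumes T: "completes c P T" and w: "w \<in> V" "w \<notin> P"
    and card: "\<And>c'. \<forall>v\<in>P. c' v = c v \<Longrightarrow> card (c' ` (N w - T) \<inter> L w) < k"
  shows "completes c P (insert w T)"
proof (cases "w \<in> T")
  case True
  then show ?thesis using T by (simp add: insert_absorb)
next
  case wT: False
  show ?thesis
    unfolding completes_def
  proof (intro allI impI)
    fix c' assume c': "\<forall>v\<in>P. c' v = c v" "colours c' (V - insert w T)"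
    have "card (c' ` (N w - T) \<inter> L w) < card (L w)"
      using card[OF c'(1)] lists w by simp
    then have "\<not> L w \<subseteq> c' ` (N w - T)" by (auto simp: Int_absorb1)
    then obtain a where a: "a \<in> L w" "a \<notin> c' ` (N w - T)" by blast
    let ?c = "c'(w := a)"
    have "?c v \<in> L v" if "v \<in> V - T" for v
      using that a c' by (auto simp: colours_def)
    moreover have "?c u \<noteq> ?c v" if uv: "u \<in> V - T" "v \<in> V - T" "adj u v" for u v
    proof (cases "u = w \<or> v = w")
      case False
      then show ?thesis using uv c' by (auto simp: colours_def)
    next
      case True
      then show ?thesis
      proof
        assume "u = w"
        then show ?thesis using uv a irrefl by (auto simp: N_def)
      next
        assume "v = w"
        then show ?thesis using uv a irrefl sym[OF uv(3)] by (auto simp: N_def)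
      qed
    qed
    ultimately have "colours ?c (V - T)" unfolding colours_def by blast
    moreover have "\<forall>v\<in>P. ?c v = c v" using c'(1) w by auto
    ultimately show "\<exists>c''. colours c'' V" using T unfolding completes_def by blast
  qed
qed

text \<open>\<open>S\<close> collects neighbours of \<open>w\<close> that are coloured later; one of
  them suffices at a vertex of degree \<open>k\<close>, two at degree \<open>k + 1\<close>.\<close>

lemma completes_insert_card:
  assumes "completes c P T" "w \<in> V" "w \<notin> P" "S \<subseteq> N w \<inter> T" "card (N w) < k + card S"
  shows "completes c P (insert w T)"
proof (rule completes_insert[OF assms(1-3)])
  fix c' assume "\<forall>v\<in>P. c' v = c v"
  have fS: "finite S" using assms(4) by (meson finN finite_Int finite_subset)
  have "card (c' ` (N w - T) \<inter> L w) \<le> card (c' ` (N w - T))"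
    by (rule card_mono) auto
  also have "\<dots> \<le> card (N w - T)" by (simp add: card_image_le)
  also have "\<dots> \<le> card (N w - S)" using assms(4) by (intro card_mono) auto
  also have "\<dots> = card (N w) - card S" using assms(4) fS by (simp add: card_Diff_subset)
  finally show "card (c' ` (N w - T) \<inter> L w) < k" using assms(5) card_mono[OF finN[of w], of S] assms(4)
    by auto
qed

text \<open>Two later neighbours balance a degree of \<open>k + 1\<close>. They already lie in
  \<open>T\<close>, so the vertices of \<open>S\<close> can be inserted in any order.\<close>

lemma completes_Un:
  assumes T: "completes c P T" and S: "S \<subseteq> V" "S \<inter> P = {}"
    and nb: "\<And>w. w \<in> S \<Longrightarrow> \<exists>i j. i \<noteq> j \<and> i \<in> N w \<inter> T \<and> j \<in> N w \<inter> T"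
    and deg: "\<And>w. w \<in> S \<Longrightarrow> card (N w) \<le> k + 1"
  shows "completes c P (T \<union> S)"
proof -
  have "finite S" using S fin finite_subset by blast
  then show ?thesis using S nb deg
  proof (induction S)
    case empty
    then show ?case using T by simp
  next
    case (insert w S)
    obtain i j where ij: "i \<noteq> j" "i \<in> N w \<inter> T" "j \<in> N w \<inter> T"
      using insert.prems(3)[of w] by auto
    have "card (N w) < k + card {i, j}" using insert.prems(4)[of w] ij by simp
    then have "completes c P (insert w (T \<union> S))"
      using insert.IH insert.prems ij
      by (intro completes_insert_card[where S = "{i, j}"]) auto
    then show ?case by simp
  qed
qed

text \<open>At \<open>v\<close>, coloured last, the pair saves one of at most \<open>k\<close>
  colours. At \<open>u\<close> the uncoloured \<open>v\<close> saves one; if \<open>u\<close> has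
  degree \<open>k + 1\<close>, the same pair has to save another, so its colours are chosen with
  regard to both \<open>L u\<close> and \<open>L v\<close>.\<close>

lemma completes_one_pair:
  assumes k: "k > 0" and V: "{x, y, u, v} \<subseteq> V"
    and xy: "x \<noteq> y" "\<not> adj x y" and v: "adj v x" "adj v y" "adj v u" "card (N v) \<le> k"
    and u: "u \<noteq> x" "u \<noteq> y" "card (N u) \<le> k + 1" "card (N u) \<le> k \<or> adj u x \<and> adj u y"
  obtains c where "colours c {x, y}" "completes c {x, y} {u, v}"
proof -
  obtain a b where ab: "a \<in> L x" "b \<in> L y" "a = b \<or> a \<notin> L u \<or> b \<notin> L u" "a = b \<or> a \<notin> L v \<or> b \<notin> L v"
    by (rule pair_colours[of "L x" "L y" "L u" "L v" k]) (use lists V k in auto)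
  define c where "c = (\<lambda>z. if z = x then a else b)"
  have "\<not> adj y x" using xy sym by blast
  then have col: "colours c {x, y}" using ab xy irrefl by (auto simp: colours_def c_def)
  have xyN: "x \<in> N v" "y \<in> N v" "v \<in> N u" using V v sym by (auto simp: N_def)
  have vP: "v \<notin> {x, y}" using v irrefl by auto
  have uv: "u \<noteq> v" using v irrefl by auto
  have "completes c {x, y} (insert v {})"
  proof (rule completes_insert[OF completes_empty])
    show "v \<in> V" "v \<notin> {x, y}" using V vP by auto
    fix c' assume c': "\<forall>v\<in>{x, y}. c' v = c v"
    then have "redundant c' (L v) x y" using ab xy by (auto simp: redundant_def c_def)
    from card_image_redundant[OF finN xyN(1,2) xy(1) this]
    show "card (c' ` (N v - {}) \<inter> L v) < k" using v by simp
  qed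
  then have "completes c {x, y} (insert u {v})"
  proof (rule completes_insert)
    show "u \<in> V" "u \<notin> {x, y}" using V u by auto
    fix c' assume c': "\<forall>v\<in>{x, y}. c' v = c v"
    have cN: "card (N u - {v}) + 1 = card (N u)" using xyN
      by (metis Suc_eq_plus1 card_Suc_Diff1 finN)
    show "card (c' ` (N u - {v}) \<inter> L u) < k"
    proof (cases "card (N u) \<le> k")
      case True
      have "card (c' ` (N u - {v}) \<inter> L u) \<le> card (c' ` (N u - {v}))" by (intro card_mono) auto
      also have "\<dots> \<le> card (N u - {v})" by (simp add: card_image_le)
      finally show ?thesis using cN True by simp
    next
      case False
      then have "x \<in> N u - {v}" "y \<in> N u - {v}" using u vP V by (auto simp: N_def)
      moreover have "redundant c' (L u) x y" using ab xy c' by (auto simp: redundant_def c_def)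
      ultimately have "card (c' ` (N u - {v}) \<inter> L u) + 1 \<le> card (N u - {v})"
        using card_image_redundant[of "N u - {v}" x y c' "L u"] xy by simp
      then show ?thesis using cN u by simp
    qed
  qed
  then show ?thesis using that col by blast
qed

text \<open>A vertex \<open>v\<close> of degree \<open>k + 1\<close> coloured last lacks two
  colours, and each pair gains one. Only the first pair also serves \<open>u\<close>.\<close>

lemma completes_two_pairs:
  assumes k: "k > 4" and V: "{x, y, z, w, u, v} \<subseteq> V"
    and xy: "x \<noteq> y" "\<not> adj x y" and zw: "z \<noteq> w" "\<not> adj z w" and disj: "{x, y} \<inter> {z, w} = {}"
    and v: "adj v x" "adj v y" "adj v z" "adj v w" "adj v u" "card (N v) \<le> k + 1"
    and u: "u \<notin> {x, y, z, w}" "card (N u) \<le> k + 1" "card (N u) \<le> k \<or> adj u x \<and> adj u y"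
  obtains c where "colours c {x, y, z, w}" "completes c {x, y, z, w} {u, v}"
proof -
  let ?P = "{x, y, z, w}"
  obtain a b where ab: "a \<in> L x" "b \<in> L y" "a = b \<or> a \<notin> L u \<or> b \<notin> L u" "a = b \<or> a \<notin> L v \<or> b \<notin> L v"
    by (rule pair_colours[of "L x" "L y" "L u" "L v" k]) (use lists V k in auto)
  have c2: "card (L s - {a, b}) \<ge> k - 2" if "s \<in> V" for s
  proof -
    have "card {a, b} \<le> 2" by (simp add: card_insert_if)
    then show ?thesis using diff_card_le_card_Diff[of "{a, b}" "L s"] lists[OF that] by force
  qed
  \<comment> \<open>Avoiding \<open>a\<close> and \<open>b\<close> makes the pairs compatible
    whatever the adjacencies between them. At least \<open>k - 2\<close> colours remain in each
    list, and \<open>2 * (k - 2) > k\<close> as \<open>k > 4\<close>.\<close>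
  obtain a' b' where ab': "a' \<in> L z - {a, b}" "b' \<in> L w - {a, b}" "a' = b' \<or> a' \<notin> L v \<or> b' \<notin> L v"
  proof (rule pair_colours_large[of "L z - {a, b}" "L w - {a, b}" "L v"])
    show "finite (L z - {a, b})" "finite (L w - {a, b})" "finite (L v)" using lists V by auto
    show "card (L v) < card (L z - {a, b}) + card (L w - {a, b})"
      using c2[of z] c2[of w] lists[of v] V k by auto
    have "card (L z - {a, b}) \<noteq> 0" "card (L w - {a, b}) \<noteq> 0" using c2[of z] c2[of w] V k by auto
    then show "L z - {a, b} \<noteq> {}" "L w - {a, b} \<noteq> {}" by force+
  qed auto
  define c where "c = (\<lambda>s. if s = x then a else if s = y then b else if s = z then a' else b')"
  have cv: "c x = a" "c y = b" "c z = a'" "c w = b'" using xy zw disj by (auto simp: c_def)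
  have "\<not> adj y x" "\<not> adj w z" using xy zw sym by blast+
  then have col: "colours c ?P" using ab ab' xy zw irrefl by (auto simp: colours_def cv)
  have N: "x \<in> N v" "y \<in> N v" "z \<in> N v" "w \<in> N v" "v \<in> N u" using V v sym by (auto simp: N_def)
  have vP: "v \<notin> ?P" using v irrefl by auto
  have "completes c ?P (insert v {})"
  proof (rule completes_insert[OF completes_empty])
    show "v \<in> V" "v \<notin> ?P" using V vP by auto
    fix c' assume c': "\<forall>v\<in>?P. c' v = c v"
    then have "redundant c' (L v) x y" "redundant c' (L v) z w"
      using ab ab' by (auto simp: redundant_def cv)
    from card_image_redundant2[OF finN N(1,2) xy(1) this(1) N(3,4) zw(1) this(2) disj]
    show "card (c' ` (N v - {}) \<inter> L v) < k" using v by simp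
  qed
  then have "completes c ?P (insert u {v})"
  proof (rule completes_insert)
    show "u \<in> V" "u \<notin> ?P" using V u by auto
    fix c' assume c': "\<forall>v\<in>?P. c' v = c v"
    have cN: "card (N u - {v}) + 1 = card (N u)" using N
      by (metis Suc_eq_plus1 card_Suc_Diff1 finN)
    show "card (c' ` (N u - {v}) \<inter> L u) < k"
    proof (cases "card (N u) \<le> k")
      case True
      have "card (c' ` (N u - {v}) \<inter> L u) \<le> card (c' ` (N u - {v}))" by (intro card_mono) auto
      also have "\<dots> \<le> card (N u - {v})" by (simp add: card_image_le)
      finally show ?thesis using cN True by simp
    next
      case False
      then have "x \<in> N u - {v}" "y \<in> N u - {v}" using u vP V by (auto simp: N_def)
      moreover have "redundant c' (L u) x y" using ab c' by (auto simp: redundant_def cv)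
      ultimately have "card (c' ` (N u - {v}) \<inter> L u) + 1 \<le> card (N u - {v})"
        using card_image_redundant[of "N u - {v}" x y c' "L u"] xy by simp
      then show ?thesis using cN u by simp
    qed
  qed
  then show ?thesis using that col by blast
qed

end

section \<open>Dense graphs\<close>

context list_graph
begin

text \<open>The neighbourhood in the complement graph.\<close>

definition coN :: "'a \<Rightarrow> 'a set" where "coN v = {w \<in> V. w \<noteq> v \<and> \<not> adj v w}"

lemma fin_coN [simp]: "finite (coN v)"
  by (simp add: coN_def fin)

lemma card_coN: "v \<in> V \<Longrightarrow> card (N v) + card (coN v) + 1 = card V"
proof -
  assume v: "v \<in> V"
  have "V = insert v (N v \<union> coN v)" using v by (auto simp: N_def coN_def)
  moreover have "v \<notin> N v \<union> coN v" "N v \<inter> coN v = {}" using irrefl by (auto simp: N_def coN_def)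
  ultimately show ?thesis
    using card_Un_disjoint[of "N v" "coN v"] card_insert_disjoint[of "N v \<union> coN v" v] by auto
qed

text \<open>The common neighbours of \<open>u\<close> and \<open>v\<close> outside \<open>P\<close>
  come just before these two. Together they form a set \<open>T\<close> of at least
  \<open>d + 2\<close> vertices, of which any other vertex misses at most \<open>d\<close>; so it
  has two neighbours in \<open>T\<close>.\<close>

lemma dense_sweep:
  assumes M: "\<And>w. w \<in> V \<Longrightarrow> card (coN w) \<le> d" and V: "card P + 3 * d + 2 \<le> card V"
    and deg: "\<And>w. w \<in> V \<Longrightarrow> card (N w) \<le> k + 1"
    and P: "P \<subseteq> V" and uv: "u \<in> V - P" "v \<in> V - P" "u \<noteq> v"
    and c: "colours c P" "completes c P {u, v}"
  shows "\<exists>c. colours c V"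
proof -
  define S where "S = V - P - {u, v} - coN u - coN v"
  define T where "T = {u, v} \<union> S"
  have finP: "finite P" using P fin finite_subset by blast
  have "completes c P T"
    unfolding T_def
  proof (rule completes_Un[OF c(2)])
    fix w assume "w \<in> S"
    then have "w \<in> V" "u \<in> N w" "v \<in> N w"
      using uv sym by (auto simp: S_def N_def coN_def)
    then show "\<exists>i j. i \<noteq> j \<and> i \<in> N w \<inter> {u, v} \<and> j \<in> N w \<inter> {u, v}" "card (N w) \<le> k + 1"
      using uv deg by auto
  qed (auto simp: S_def)
  have finT: "finite T" by (auto simp: T_def S_def fin)
  have "V \<subseteq> P \<union> T \<union> coN u \<union> coN v" by (auto simp: T_def S_def)
  then have "card V \<le> card (P \<union> T \<union> coN u \<union> coN v)"
    using finP finT by (intro card_mono) auto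
  also have "\<dots> \<le> card P + card T + card (coN u) + card (coN v)"
    by (intro order.trans[OF card_Un_le] add_mono order.refl)
  finally have T: "d + 2 \<le> card T" using V M[of u] M[of v] uv by auto
  have "completes c P (T \<union> (V - P - T))"
  proof (rule completes_Un[OF \<open>completes c P T\<close>])
    fix w assume w: "w \<in> V - P - T"
    have "T - coN w \<subseteq> N w \<inter> T"
      using w uv by (auto simp: T_def S_def N_def coN_def)
    then have "card (T - coN w) \<le> card (N w \<inter> T)" by (intro card_mono) auto
    moreover have "card T - card (coN w) \<le> card (T - coN w)" by (simp add: diff_card_le_card_Diff)
    ultimately have "2 \<le> card (N w \<inter> T)" using T M[of w] w by auto
    then show "\<exists>i j. i \<noteq> j \<and> i \<in> N w \<inter> T \<and> j \<in> N w \<inter> T"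
      by (auto simp: numeral_2_eq_2 card_le_Suc_iff)
    show "card (N w) \<le> k + 1" using w deg by auto
  qed auto
  moreover have "T \<union> (V - P - T) = V - P" using uv by (auto simp: T_def S_def)
  ultimately show ?thesis using completes_all[OF c(1)] P by simp
qed

lemma coN_sym: "x \<in> V \<Longrightarrow> y \<in> coN x \<Longrightarrow> x \<in> coN y"
  using sym by (auto simp: coN_def)

text \<open>The complement is a matching, and \<open>{x, y}\<close> and \<open>{z, w}\<close> are
  two of its edges. A vertex off these edges is adjacent to all four ends, so \<open>v\<close> can
  be any such vertex and \<open>u\<close> any further neighbour of \<open>v\<close>.\<close>

lemma dense_two_pairs:
  assumes k: "8 \<le> k" and V: "10 \<le> card V" and M: "\<And>w. w \<in> V \<Longrightarrow> card (coN w) \<le> 1"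
    and deg: "\<And>w. w \<in> V \<Longrightarrow> card (N w) \<le> k + 1"
    and xy: "x \<in> V" "y \<in> coN x" and zw: "z \<in> V" "w \<in> coN z" "z \<notin> {x, y}" "w \<notin> {x, y}"
  shows "\<exists>c. colours c V"
proof -
  have V4: "y \<in> V" "w \<in> V" using xy zw by (auto simp: coN_def)
  have single: "b = b'" if "a \<in> V" "b \<in> coN a" "b' \<in> coN a" for a b b'
    using M[OF that(1)] that(2,3) card_le_Suc0_iff_eq[of "coN a"] by auto
  have ne: "\<exists>s. s \<in> V - X" if "finite X" "card X < 10" for X
  proof (rule ccontr)
    assume "\<not> ?thesis"
    then have "card V \<le> card X" using that by (intro card_mono) auto
    then show False using that V by simp
  qed
  have c4: "card {x, y, z, w} \<le> 4" by (simp add: card_insert_if)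
  obtain v where v: "v \<in> V - {x, y, z, w}" using ne[of "{x, y, z, w}"] c4 by auto
  have "card (insert v (coN v)) \<le> 2" using M[of v] v by (simp add: card_insert_if)
  then have "card ({x, y, z, w} \<union> insert v (coN v)) \<le> 4 + 2"
    by (intro order.trans[OF card_Un_le] add_mono c4)
  then obtain u where u: "u \<in> V - ({x, y, z, w} \<union> insert v (coN v))"
    using ne[of "{x, y, z, w} \<union> insert v (coN v)"] by auto
  have all: "adj s x" "adj s y" "adj s z" "adj s w" if "s \<in> V - {x, y, z, w}" for s
  proof -
    have "x \<in> coN y" "z \<in> coN w" using coN_sym xy zw by auto
    then have "s \<notin> coN x" "s \<notin> coN y" "s \<notin> coN z" "s \<notin> coN w"
      using that single[of x y s] single[of y x s] single[of z w s] single[of w z s] xy zw V4 by blast+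
    then have "adj x s" "adj y s" "adj z s" "adj w s"
      using that by (auto simp: coN_def)
    then show "adj s x" "adj s y" "adj s z" "adj s w" by (auto intro: sym)
  qed
  have xyzw: "x \<noteq> y" "\<not> adj x y" "z \<noteq> w" "\<not> adj z w" using xy zw by (auto simp: coN_def)
  have vu: "adj v u" using u by (auto simp: coN_def)
  obtain c where c: "colours c {x, y, z, w}" "completes c {x, y, z, w} {u, v}"
  proof (rule completes_two_pairs[of x y z w u v])
    show "{x, y, z, w, u, v} \<subseteq> V" using xy zw V4 u v by blast
    show "{x, y} \<inter> {z, w} = {}" "u \<notin> {x, y, z, w}" using zw u by auto
    show "card (N v) \<le> k + 1" "card (N u) \<le> k + 1" using deg u v by blast+
    show "adj v x" "adj v y" "adj v z" "adj v w" using all v by blast+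
    show "card (N u) \<le> k \<or> adj u x \<and> adj u y" using all u by blast
  qed (use k xyzw vu in auto)
  show ?thesis
  proof (rule dense_sweep[OF M _ deg _ _ _ _ c])
    show "{x, y, z, w} \<subseteq> V" "u \<in> V - {x, y, z, w}" "v \<in> V - {x, y, z, w}" "u \<noteq> v"
      using xy zw V4 u v by blast+
  qed (use c4 V in auto)
qed

lemma dense_low:
  assumes k: "8 \<le> k" and V: "11 \<le> card V" and M: "\<And>w. w \<in> V \<Longrightarrow> 1 \<le> card (coN w) \<and> card (coN w) \<le> 2"
    and deg: "\<And>w. w \<in> V \<Longrightarrow> card (N w) \<le> k + 1" and v: "v \<in> V" "card (N v) \<le> k"
  shows "\<exists>c. colours c V"
proof -
  have ne: "\<exists>s. s \<in> V - X" if "finite X" "card X < 11" for X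
  proof (rule ccontr)
    assume "\<not> ?thesis"
    then have "card V \<le> card X" using that by (intro card_mono) auto
    then show False using that V by simp
  qed
  have M2: "card (coN w) \<le> 2" if "w \<in> V" for w using M that by simp
  have MV: "coN v \<subseteq> V" by (auto simp: coN_def)
  have "card (\<Union>p\<in>coN v. coN p) \<le> (\<Sum>p\<in>coN v. card (coN p))" by (rule card_UN_le) simp
  also have "\<dots> \<le> card (coN v) * 2" using sum_bounded_above[of "coN v" "\<lambda>p. card (coN p)" 2] M2 MV by auto
  finally have "card (\<Union>p\<in>coN v. coN p) \<le> 4" using M2[OF v(1)] by linarith
  then have "card (insert v (coN v) \<union> (\<Union>p\<in>coN v. coN p)) \<le> 7"
    using card_Un_le[of "insert v (coN v)" "\<Union>p\<in>coN v. coN p"] M2[OF v(1)] card_insert_le_m1[of 3 "coN v" v]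
    by auto
  \<comment> \<open>Excluding the nonneighbours of nonneighbours of \<open>v\<close> makes every
    nonneighbour \<open>y\<close> of \<open>x\<close> adjacent to \<open>v\<close>; at most 7
    vertices are excluded.\<close>
  then obtain x where x: "x \<in> V - (insert v (coN v) \<union> (\<Union>p\<in>coN v. coN p))"
    using ne[of "insert v (coN v) \<union> (\<Union>p\<in>coN v. coN p)"] by auto
  have "card (coN x) \<noteq> 0" using M[of x] x by auto
  then obtain y where y: "y \<in> coN x" by fastforce
  have yV: "y \<in> V" using y by (auto simp: coN_def)
  have yv: "y \<noteq> v" "y \<notin> coN v" using x y coN_sym[of x y] by auto
  have "card (insert v (coN v) \<union> ({x, y} \<union> (coN x \<union> coN y))) \<le> 3 + (2 + (2 + 2))"
    by (intro order.trans[OF card_Un_le] add_mono card_insert_le_m1)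
      (use M2[of v] M2[of x] M2[of y] v x yV in \<open>auto simp: card_insert_if\<close>)
  then obtain u where u: "u \<in> V - (insert v (coN v) \<union> ({x, y} \<union> (coN x \<union> coN y)))"
    using ne[of "insert v (coN v) \<union> ({x, y} \<union> (coN x \<union> coN y))"] by auto
  have xy: "x \<noteq> y" "\<not> adj x y" using y by (auto simp: coN_def)
  have a: "adj v x" "adj v y" "adj v u" "adj x u" "adj y u"
    using x u yv yV v by (auto simp: coN_def)
  have a': "adj u x" "adj u y" using a sym by blast+
  obtain c where c: "colours c {x, y}" "completes c {x, y} {u, v}"
    by (rule completes_one_pair[of x y u v]) (use k x yV u v xy a a' deg[of u] in auto)
  have "card {x, y} \<le> 2" by (simp add: card_insert_if)
  then show ?thesis
    by (intro dense_sweep[of 2 "{x, y}" u v c]) (use V M2 deg c u v x yV yv in auto)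
qed

text \<open>A vertex misses at most \<open>card V - k - 1\<close> others. With \<open>k + 1\<close>
  vertices a nonadjacent pair exists although nothing is missed, a contradiction. With
  \<open>k + 2\<close> the complement is a matching, and deleting any one vertex leaves a
  nonadjacent pair. With \<open>k + 3\<close> every vertex misses one or two others.\<close>

lemma dense_colourable:
  assumes k: "8 \<le> k" and V: "card V \<le> k + 3" "V \<noteq> {}"
    and deg: "\<And>w. w \<in> V \<Longrightarrow> k \<le> card (N w) \<and> card (N w) \<le> k + 1"
    and cl: "\<And>S. S \<subseteq> V \<Longrightarrow> card S = k + 1 \<Longrightarrow> \<exists>x\<in>S. \<exists>y\<in>S. x \<noteq> y \<and> \<not> adj x y"
  shows "\<exists>c. colours c V"
proof -
  have degle: "card (N w) \<le> k + 1" if "w \<in> V" for w using deg that by blast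
  obtain v0 where v0: "v0 \<in> V" using V by blast
  have Vk: "k + 1 \<le> card V" using card_coN[OF v0] deg[OF v0] by linarith
  have pair: "\<exists>x\<in>V - X. \<exists>y\<in>V - X. y \<in> coN x" if X: "X \<subseteq> V" "card X + k + 1 = card V" for X
  proof -
    have "card (V - X) = k + 1" using X fin by (simp add: card_Diff_subset finite_subset)
    then obtain x y where "x \<in> V - X" "y \<in> V - X" "x \<noteq> y" "\<not> adj x y"
      using cl[of "V - X"] by blast
    then show ?thesis by (intro bexI[of _ x] bexI[of _ y]) (auto simp: coN_def)
  qed
  consider "card V = k + 1" | "card V = k + 2" | "card V = k + 3" using V Vk by linarith
  then show ?thesis
  proof cases
    case 1
    then obtain x y where "x \<in> V" "y \<in> coN x" using pair[of "{}"] by auto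
    moreover have "coN x = {}" using card_coN[of x] deg[of x] 1 \<open>x \<in> V\<close> by auto
    ultimately show ?thesis by simp
  next
    case 2
    have M: "card (coN w) \<le> 1" if "w \<in> V" for w using card_coN[OF that] deg[OF that] 2 by linarith
    obtain x y where xy: "x \<in> V" "y \<in> coN x" using pair[of "{v0}"] v0 2 by auto
    have yV: "y \<in> V" using xy by (auto simp: coN_def)
    \<comment> \<open>A pair that avoids \<open>x\<close> also avoids \<open>y\<close>, whose only
      nonneighbour is \<open>x\<close>.\<close>
    obtain z w where zw: "z \<in> V" "w \<in> V" "z \<noteq> x" "w \<noteq> x" "w \<in> coN z" using pair[of "{x}"] xy 2 by auto
    have single: "b = b'" if "a \<in> V" "b \<in> coN a" "b' \<in> coN a" for a b b'
      using M[OF that(1)] that(2,3) card_le_Suc0_iff_eq[of "coN a"] by auto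
    have xM: "x \<in> coN y" "z \<in> coN w" using coN_sym xy(1,2) zw(1,5) by blast+
    then have "z \<noteq> y" "w \<noteq> y" using single[of y x w] single[of y x z] yV zw(3-5) by blast+
    then show ?thesis
      by (intro dense_two_pairs[OF k _ M degle xy zw(1,5)]) (use 2 k zw in auto)
  next
    case 3
    have M: "1 \<le> card (coN w) \<and> card (coN w) \<le> 2" if "w \<in> V" for w
      using card_coN[OF that] deg[OF that] 3 by linarith
    show ?thesis
    proof (cases "\<exists>v\<in>V. card (N v) = k")
      case True
      then obtain v where "v \<in> V" "card (N v) \<le> k" by auto
      then show ?thesis by (intro dense_low[OF k _ M degle]) (use 3 k in auto)
    next
      \<comment> \<open>Without low vertices the complement is a perfect matching, and any edge of
        it other than \<open>{v0, y}\<close> gives the second pair.\<close>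
      case False
      have M1: "card (coN w) = 1" if "w \<in> V" for w
      proof -
        have "card (N w) \<noteq> k" using False that by blast
        then show ?thesis using card_coN[OF that] deg[OF that] 3 by linarith
      qed
      obtain y where y: "coN v0 = {y}" using M1[OF v0] by (auto simp: card_1_singleton_iff)
      have yV: "y \<in> V" using y by (auto simp: coN_def)
      have "\<not> V \<subseteq> {v0, y}"
      proof
        assume "V \<subseteq> {v0, y}"
        then have "card V \<le> card {v0, y}" by (intro card_mono) auto
        also have "\<dots> \<le> 2" by (simp add: card_insert_if)
        finally show False using 3 k by simp
      qed
      then obtain z where z: "z \<in> V" "z \<notin> {v0, y}" by blast
      obtain w where w: "coN z = {w}" using M1[OF z(1)] by (auto simp: card_1_singleton_iff)
      obtain y' where y': "coN y = {y'}" using M1[OF yV] by (auto simp: card_1_singleton_iff)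
      have "v0 \<in> coN y" using coN_sym[of v0 y] v0 y by auto
      then have "w \<noteq> v0" "w \<noteq> y" using coN_sym[of z w] z w y y' by auto
      show ?thesis
      proof (rule dense_two_pairs[OF k _ _ degle v0 _ z(1)])
        show "y \<in> coN v0" "w \<in> coN z" "z \<notin> {v0, y}" "w \<notin> {v0, y}"
          using y z w \<open>w \<noteq> v0\<close> \<open>w \<noteq> y\<close> by auto
      qed (use k 3 M1 in auto)
    qed
  qed
qed

end

section \<open>Pairs that do not block the way round the circle\<close>

text \<open>The vertices are numbered along the circle by the integers (periodically); \<open>i\<close> is adjacent to
  the vertices of \<open>{l i..r i} - {i}\<close>. Every degree \<open>r i - l i\<close> is \<open>k\<close> (a low vertex) or \<open>k + 1\<close>
  (a high one), and \<open>{i..r i}\<close> is a clique, hence \<open>r i - i < k\<close>.\<close>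

definition wheel :: "int \<Rightarrow> (int \<Rightarrow> int) \<Rightarrow> (int \<Rightarrow> int) \<Rightarrow> bool" where
  "wheel k r l \<longleftrightarrow> (\<forall>i. l i \<le> i \<and> i \<le> r i \<and> k \<le> r i - l i \<and> r i - l i \<le> k + 1 \<and> r i - i < k) \<and>
     (\<forall>i j. i \<le> j \<longrightarrow> (j \<le> r i \<longleftrightarrow> l j \<le> i))"

text \<open>When the vertices are coloured from right to left, those in \<open>Y\<close> having been coloured before,
  the vertex \<open>j\<close> still has enough uncoloured neighbours to its left.\<close>

definition room :: "int \<Rightarrow> (int \<Rightarrow> int) \<Rightarrow> (int \<Rightarrow> int) \<Rightarrow> int set \<Rightarrow> int \<Rightarrow> bool" where
  "room k r l Y j \<longleftrightarrow> (\<exists>i. l j \<le> i \<and> i < j \<and> i \<notin> Y \<and>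
     (r j - l j = k \<or> (\<exists>i'. i' \<noteq> i \<and> l j \<le> i' \<and> i' < j \<and> i' \<notin> Y)))"

text \<open>Configurations around a vertex \<open>p\<close> that make the greedy colouring succeed: \<open>p\<close> is coloured
  last and \<open>u\<close> last but one, after the nonadjacent pairs \<open>{p - 1, y}\<close> and \<open>{p - 2, y'}\<close> of
  neighbours of \<open>p\<close> have been coloured first. A low vertex \<open>p\<close> needs only the first pair.\<close>

definition single_pair_conf :: "int \<Rightarrow> (int \<Rightarrow> int) \<Rightarrow> (int \<Rightarrow> int) \<Rightarrow> int \<Rightarrow> int \<Rightarrow> int \<Rightarrow> bool" where
  "single_pair_conf k r l p y u \<longleftrightarrow> r p - l p = k \<and> l p < p \<and> p < y \<and> y \<le> r p \<and> p < u \<and> u \<le> r p \<and> u \<noteq> y \<and>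
     r (p - 1) < y \<and> (r u - l u = k \<or> l u < p) \<and> (\<forall>j>r p. room k r l {y} j)"

definition double_pair_conf :: "int \<Rightarrow> (int \<Rightarrow> int) \<Rightarrow> (int \<Rightarrow> int) \<Rightarrow> int \<Rightarrow> int \<Rightarrow> int \<Rightarrow> int \<Rightarrow> bool" where
  "double_pair_conf k r l p y y' u \<longleftrightarrow> l p < p - 1 \<and> p < y \<and> y \<le> r p \<and> p < y' \<and> y' \<le> r p \<and> y \<noteq> y' \<and>
     p < u \<and> u \<le> r p \<and> u \<noteq> y \<and> u \<noteq> y' \<and>
     r (p - 1) < y \<and> r (p - 2) < y' \<and> (r u - l u = k \<or> l u < p) \<and> (\<forall>j>r p. room k r l {y, y'} j)"

definition pair_conf :: "int \<Rightarrow> (int \<Rightarrow> int) \<Rightarrow> (int \<Rightarrow> int) \<Rightarrow> bool" where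
  "pair_conf k r l \<longleftrightarrow> (\<exists>p y u. single_pair_conf k r l p y u) \<or> (\<exists>p y y' u. double_pair_conf k r l p y y' u)"

text \<open>Reversing the circle exchanges the two reaches. The clique bound in \<open>wheel\<close>
  is stated for \<open>r\<close> only; it passes to \<open>l\<close> because \<open>l (- i)\<close>
  reaches \<open>- i\<close>.\<close>

lemma wheel_reflect:
  assumes "wheel k r l"
  shows "wheel k (\<lambda>i. - l (- i)) (\<lambda>i. - r (- i))"
proof -
  have reach: "l i \<le> i" "i \<le> r i" "k \<le> r i - l i" "r i - l i \<le> k + 1" "r i - i < k"
    "i \<le> j \<Longrightarrow> j \<le> r i \<longleftrightarrow> l j \<le> i" for i j
    using assms by (auto simp: wheel_def)
  have g: "j \<le> - l (- i) \<longleftrightarrow> - r (- j) \<le> i" if "i \<le> j" for i j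
    using reach(6)[of "- j" "- i"] that by linarith
  have "- l (- i) - i < k" for i
  proof -
    have "- i \<le> r (l (- i))" using reach(6)[of "l (- i)" "- i"] reach(1)[of "- i"] by simp
    then show ?thesis using reach(5)[of "l (- i)"] by linarith
  qed
  then show ?thesis using reach(1-4) g unfolding wheel_def
    by (smt (verit, best))
qed

lemma room_pair:
  assumes "l j \<le> i" "i < j" "i \<notin> Y" "l j \<le> i'" "i' < j" "i' \<notin> Y" "i \<noteq> i'"
  shows "room k r l Y j"
  using assms unfolding room_def by blast

lemma room_low:
  assumes "l j \<le> i" "i < j" "i \<notin> Y" "r j - l j = k"
  shows "room k r l Y j"
  using assms unfolding room_def by blast

text \<open>\<open>{q..q + m}\<close> is a longest clique interval.\<close>

locale max_wheel =
  fixes k :: int and r l :: "int \<Rightarrow> int" and q m :: int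
  assumes wheel: "wheel k r l" and k: "8 \<le> k" and q: "r q = q + m" and m: "\<And>i. r i \<le> i + m"
begin

lemma reach: "l i \<le> i" "i \<le> r i" "k \<le> r i - l i" "r i - l i \<le> k + 1" "r i - i < k"
    "i \<le> j \<Longrightarrow> j \<le> r i \<longleftrightarrow> l j \<le> i"
  using wheel by (auto simp: wheel_def)

lemma low_or_high: "r i - l i = k \<or> r i - l i = k + 1"
  using reach(3,4)[of i] by linarith

lemma rmono: "i \<le> j \<Longrightarrow> r i \<le> r j"
  by (smt (verit) reach)

lemma lbound: "i - m \<le> l i"
  using reach(6)[of "l i" i] reach(1)[of i] m[of "l i"] by simp

lemma mk: "m < k" "k \<le> 2 * m"
  using q reach(5)[of q] lbound[of q] reach(3)[of q] by linarith+

text \<open>Makes \<open>q + 1\<close> a suitable \<open>u\<close> when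
  \<open>p = q\<close>.\<close>

lemma left_reach_succ: "r (q + 1) - l (q + 1) = k \<or> l (q + 1) < q"
  using low_or_high[of "q + 1"] m[of "q + 1"] mk by linarith

lemma left_reach_start: "r q - l q = k \<or> l q < q - 1"
  using low_or_high[of q] q mk by linarith

lemma left_reach_start_less: "l q < q"
  using low_or_high[of q] q mk by linarith

text \<open>At most \<open>m\<close> neighbours lie to the right, so the others lie to the left.
  Such counts supply \<open>room\<close> beyond the clique.\<close>

lemma left_degree_high: "r j - l j = k \<or> l j \<le> j - (k + 1 - m)"
  using low_or_high[of j] m[of j] by linarith

lemma left_degree: "l j \<le> j - (k - m)"
  using low_or_high[of j] m[of j] by linarith

text \<open>By maximality \<open>q - 1\<close> does not reach \<open>q + m\<close>, which gives the
  pair. Beyond the clique a low vertex has at least two left neighbours and a high one three, so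
  losing \<open>q + m\<close> leaves enough.\<close>

lemma pair_conf_low:
  assumes "m \<le> k - 2" "r q - l q = k"
  shows "pair_conf k r l"
proof -
  have "room k r l {q + m} j" if "j > r q" for j
  proof (cases "r j - l j = k")
    case True
    then show ?thesis using left_degree[of j] assms that q
      by (intro room_low[where i = "if j = q + m + 1 then j - 2 else j - 1"]) auto
  next
    case False
    then have "l j \<le> j - 3" using left_degree_high[of j] assms by linarith
    then show ?thesis using that q
      by (intro room_pair[where i = "if j = q + m + 1 then j - 3 else j - 1" 
           and i' = "if j = q + m + 2 then j - 3 else j - 2"]) auto
  qed
  then have "single_pair_conf k r l q (q + m) (q + 1)"
    unfolding single_pair_conf_def using assms q m[of "q - 1"] left_reach_start_less left_reach_succ mk k by auto
  then show ?thesis by (auto simp: pair_conf_def)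
qed

text \<open>Beyond the clique one more left neighbour is guaranteed than for
  \<open>m = k - 2\<close>. This pays for removing also \<open>q + m - 1\<close>, which
  \<open>q - 2\<close> does not reach.\<close>

lemma pair_conf_small_clique:
  assumes "m \<le> k - 3"
  shows "pair_conf k r l"
proof (cases "r q - l q = k")
  case True
  then show ?thesis using pair_conf_low assms by simp
next
  case False
  have "room k r l {q + m, q + m - 1} j" if "j > r q" for j
  proof (cases "r j - l j = k")
    case True
    then show ?thesis using left_degree[of j] assms that q
      by (intro room_low[where i = "if j = q + m + 1 then j - 3 else j - 1"]) auto
  next
    case False
    then have "l j \<le> j - 4" using left_degree_high[of j] assms by linarith
    then show ?thesis using that q
      by (intro room_pair[where i = "if j = q + m + 1 then j - 3 else j - 1" 
           and i' = "if j \<le> q + m + 2 then j - 4 else j - 2"]) auto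
  qed
  then have "double_pair_conf k r l q (q + m) (q + m - 1) (q + 1)"
    unfolding double_pair_conf_def using assms q m[of "q - 1"] m[of "q - 2"] left_reach_start left_reach_start_less left_reach_succ mk k False by auto
  then show ?thesis by (auto simp: pair_conf_def)
qed

text \<open>The right members of the pairs can be taken from \<open>q + m - 3\<close> and
  \<open>q + m - 2\<close>. Then \<open>q + m - 1\<close> and \<open>q + m\<close> stay free, and
  every vertex beyond the clique still has its two nearest positions to the left available.\<close>

lemma pair_conf_short_reach:
  assumes "r (q - 1) \<le> q + m - 4" "m \<ge> 6"
  shows "pair_conf k r l"
proof -
  have *: "room k r l Y j" if "j > r q" "\<And>i. i \<in> Y \<Longrightarrow> i \<le> q + m - 2" for j Y
  proof (cases "r j - l j = k")
    case True
    then show ?thesis using left_degree[of j] assms that q mk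
      by (intro room_low[where i = "j - 1"]) fastforce+
  next
    case False
    then have "l j \<le> j - 2" using left_degree_high[of j] mk by linarith
    then show ?thesis using that q
      by (intro room_pair[where i = "j - 1" and i' = "j - 2"]) fastforce+
  qed
  show ?thesis
  proof (cases "r q - l q = k")
    case True
    moreover have "\<forall>j>r q. room k r l {q + m - 2} j" by (auto intro!: *)
    ultimately have "single_pair_conf k r l q (q + m - 2) (q + 1)"
      unfolding single_pair_conf_def using assms q left_reach_start_less left_reach_succ mk k by auto
    then show ?thesis by (auto simp: pair_conf_def)
  next
    case False
    then have "double_pair_conf k r l q (q + m - 3) (q + m - 2) (q + 1)"
      unfolding double_pair_conf_def using assms q left_reach_start left_reach_start_less left_reach_succ mk k rmono[of "q - 2" "q - 1"] by (auto intro!: *)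
    then show ?thesis by (auto simp: pair_conf_def)
  qed
qed

text \<open>With \<open>q + m\<close> and \<open>q + m - 2\<close> removed, only
  \<open>q + m + 1\<close> is in danger; by \<open>s\<close> it reaches back at least to
  \<open>q + m - 3\<close>, past the removed positions.\<close>

lemma pair_conf_clique_pred_pred:
  assumes d: "m = k - 2" and high: "r q - l q \<noteq> k"
    and t: "r (q - 2) \<le> q + m - 3" and s: "l (q + m + 1) \<le> q + 3"
  shows "pair_conf k r l"
proof -
  have "room k r l {q + m, q + m - 2} j" if j: "j > r q" for j
  proof (cases "j = q + m + 1")
    case True
    then show ?thesis using s d k
      by (intro room_pair[where i = "q + m - 1" and i' = "q + m - 3"]) auto
  next
    case False
    show ?thesis
    proof (cases "r j - l j = k")
      case True
      then show ?thesis using left_degree[of j] d j q False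
        by (intro room_low[where i = "j - 1"]) auto
    next
      case high: False
      then have "l j \<le> j - 3" using left_degree_high[of j] d by linarith
      then show ?thesis using j q False
        by (intro room_pair[where i = "j - 1" and i' = "if j = q + m + 2 then j - 3 else j - 2"]) auto
    qed
  qed
  then have "double_pair_conf k r l q (q + m) (q + m - 2) (q + 1)"
    unfolding double_pair_conf_def using d q m[of "q - 1"] left_reach_start left_reach_start_less left_reach_succ mk k high t by auto
  then show ?thesis by (auto simp: pair_conf_def)
qed

lemma pair_conf_clique_pred:
  assumes d: "m = k - 1"
    and s: "l (q + m + 1) \<le> q + 3" and t: "r (q - 1) \<ge> q + m - 3"
  shows "pair_conf k r l"
proof -
  \<comment> \<open>The vertex \<open>q + 3\<close> is adjacent to \<open>q - 1\<close> and to
    \<open>q + m + 1 = q + k\<close>. Its degree leaves no place for \<open>q - 2\<close>, which can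
    therefore be paired with it.\<close>
  have "l (q + 3) \<le> q - 1" using reach(6)[of "q - 1" "q + 3"] t d k by linarith
  moreover have "q + m + 1 \<le> r (q + 3)" using reach(6)[of "q + 3" "q + m + 1"] s d k by simp
  ultimately have "l (q + 3) > q - 2" using reach(4)[of "q + 3"] d by linarith
  then have t2: "r (q - 2) < q + 3" using reach(6)[of "q - 2" "q + 3"] by linarith
  have lm: "l (q + m) \<le> q" using reach(6)[of q "q + m"] q mk k by simp
  have L2: "r j - l j = k \<or> l j \<le> j - 2" for j using left_degree_high[of j] d by linarith
  have L1: "l j \<le> j - 1" for j using left_degree[of j] d by linarith
  \<comment> \<open>If \<open>q - 1\<close> also starts a longest clique, \<open>p = q - 1\<close>
    is used, with right members \<open>q + 3\<close> and \<open>q + 4\<close> deep inside that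
    clique. Otherwise \<open>p = q\<close> is used, as \<open>q - 1\<close> misses
    \<open>q + m - 1\<close>.\<close>
  show ?thesis
  proof (cases "r (q - 1) = q + m - 1")
    case True
    have *: "room k r l Y j" if "j > r (q - 1)" "Y \<subseteq> {q + 3, q + 4}" for j Y
    proof -
      have "l j \<le> j - 2 \<Longrightarrow> room k r l Y j"
        using that d k True by (intro room_pair[where i = "j - 1" and i' = "j - 2"]) auto
      moreover have "r j - l j = k \<Longrightarrow> room k r l Y j"
        using that d k True L1[of j] by (intro room_low[where i = "j - 1"]) auto
      ultimately show ?thesis using L2 by blast
    qed
    show ?thesis
    proof (cases "r (q - 1) - l (q - 1) = k")
      case low: True
      then have "single_pair_conf k r l (q - 1) (q + 3) q"
        unfolding single_pair_conf_def using True d k t2 left_reach_start L1[of "q - 1"] by (auto intro!: *)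
      then show ?thesis by (auto simp: pair_conf_def)
    next
      case high: False
      then have "double_pair_conf k r l (q - 1) (q + 3) (q + 4) q"
        unfolding double_pair_conf_def using True d k t2 left_reach_start L2[of "q - 1"] rmono[of "q - 3" "q - 2"]
        by (auto intro!: *)
      then show ?thesis by (auto simp: pair_conf_def)
    qed
  next
    case False
    then have t1: "r (q - 1) \<le> q + m - 2" using m[of "q - 1"] by linarith
    have *: "room k r l Y j" if "j > r q" "Y \<subseteq> {q + m - 1, q + 3}" for j Y
    proof (cases "j = q + m + 1")
      case True
      then show ?thesis using s d k that
        by (intro room_pair[where i = "q + m" and i' = "q + m - 2"]) auto
    next
      case ne: False
      have "l j \<le> j - 2 \<Longrightarrow> room k r l Y j"
        using that d k q ne by (intro room_pair[where i = "j - 1" and i' = "j - 2"]) auto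
      moreover have "r j - l j = k \<Longrightarrow> room k r l Y j"
        using that d k q ne L1[of j] by (intro room_low[where i = "j - 1"]) auto
      ultimately show ?thesis using L2 by blast
    qed
    show ?thesis
    proof (cases "r q - l q = k")
      case True
      then have "single_pair_conf k r l q (q + m - 1) (q + 1)"
        unfolding single_pair_conf_def using d k q t1 left_reach_start_less left_reach_succ by (auto intro!: *)
      then show ?thesis by (auto simp: pair_conf_def)
    next
      case False
      then have "double_pair_conf k r l q (q + m - 1) (q + 3) (q + 1)"
        unfolding double_pair_conf_def using d k q t1 t2 left_reach_start left_reach_start_less left_reach_succ by (auto intro!: *)
      then show ?thesis by (auto simp: pair_conf_def)
    qed
  qed
qed

lemma mirror: "max_wheel k (\<lambda>i. - l (- i)) (\<lambda>i. - r (- i)) (- (q + m)) m"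
proof
  show "wheel k (\<lambda>i. - l (- i)) (\<lambda>i. - r (- i))" by (rule wheel_reflect[OF wheel])
  have "l (q + m) = q" using reach(6)[of q "q + m"] lbound[of "q + m"] q mk k by simp
  then show "- l (- (- (q + m))) = - (q + m) + m" by (simp add: add.commute)
  show "- l (- i) \<le> i + m" for i using lbound[of "- i"] by linarith
qed (rule k)

end

text \<open>The extremal lemmas are applied to a longest clique and to its mirror image. For
  \<open>m \<ge> k - 2\<close> a short reach into the clique from just outside, on either side,
  settles the matter, so both outer vertices may be assumed to reach far into it.\<close>

lemma wheel_has_pair_conf:
  assumes "wheel k r l" "8 \<le> k"
  shows "pair_conf k r l \<or> pair_conf k (\<lambda>i. - l (- i)) (\<lambda>i. - r (- i))"
proof -
  \<comment> \<open>The reaches are bounded, so a longest clique interval exists although there are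
    infinitely many positions.\<close>
  have b: "r i - i \<in> {0..k}" for i using assms(1) by (auto simp: wheel_def less_imp_le)
  let ?S = "range (\<lambda>i. r i - i)"
  have fS: "finite ?S" using b by (meson finite_atLeastAtMost_int finite_subset image_subsetI)
  obtain q where q: "Max ?S = r q - q" using Max_in[OF fS] by blast
  interpret max_wheel k r l q "r q - q"
  proof
    show "r i \<le> i + (r q - q)" for i using Max_ge[OF fS, of "r i - i"] q by simp
  qed (use assms in auto)
  define m where "m = r q - q"
  interpret M: max_wheel k "\<lambda>i. - l (- i)" "\<lambda>i. - r (- i)" "- r q" m
    using mirror by (simp add: m_def)
  have rq: "q + m = r q" by (simp add: m_def)
  consider "m \<le> k - 3" | "m = k - 2" | "m = k - 1" using mk m_def by linarith
  then show ?thesis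
  proof cases
    case 1
    then show ?thesis using pair_conf_small_clique m_def by simp
  next
    case 2
    consider "r q - l q = k" | "- l (r q) - - r (r q) = k" | "r (q - 1) \<le> q + m - 4"
      | "l (r q + 1) \<ge> q + 4" 
      | "r q - l q \<noteq> k" "- l (r q) - - r (r q) \<noteq> k" "r (q - 1) > q + m - 4" "l (r q + 1) < q + 4"
      by linarith
    then show ?thesis
    proof cases
      case 1
      then show ?thesis using pair_conf_low 2 m_def by simp
    next
      case c: 2
      then show ?thesis using M.pair_conf_low 2 by simp
    next
      case 3
      then show ?thesis using pair_conf_short_reach 2 assms m_def by simp
    next
      case 4
      then show ?thesis using M.pair_conf_short_reach 2 assms rq by (simp add: add.commute)
    next
      case 5
      show ?thesis
      proof (cases "r (q - 2) \<le> q + m - 3")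
        case True
        then show ?thesis using pair_conf_clique_pred_pred 2 5 m_def rq by simp
      next
        case False
        \<comment> \<open>If \<open>q - 2\<close> reaches \<open>q + m - 2\<close>, the degree of
          \<open>q + m - 2\<close> keeps it from reaching \<open>q + m + 2\<close>, so the mirror
          image satisfies the hypothesis on the second vertex outside.\<close>
        then have "l (q + m - 2) \<le> q - 2" using reach(6)[of "q - 2" "q + m - 2"] 2 assms by linarith
        then have "r (q + m - 2) \<le> q + m + 1" using reach(4)[of "q + m - 2"] 2 by linarith
        then have "l (q + m + 2) > q + m - 2" using reach(6)[of "q + m - 2" "q + m + 2"] by linarith
        then have "q + 3 \<le> l (q + m + 2)" using 2 assms by linarith
        moreover have "- (- r q - 2) = q + m + 2" using rq by simp
        ultimately have "- l (- (- r q - 2)) \<le> - r q + m - 3" using rq by (simp only:)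
        moreover have "- (- r q + m + 1) = q - 1" using rq by simp
        then have "- r (- (- r q + m + 1)) \<le> - r q + 3" using 5 rq by (simp only:)
        ultimately show ?thesis using M.pair_conf_clique_pred_pred 2 5 by simp
      qed
    qed
  next
    case 3
    consider "r (q - 1) \<le> q + m - 4" | "l (r q + 1) \<ge> q + 4" 
      | "r (q - 1) > q + m - 4" "l (r q + 1) < q + 4"
      by linarith
    then show ?thesis
    proof cases
      case 1
      then show ?thesis using pair_conf_short_reach 3 assms m_def by simp
    next
      case 2
      then show ?thesis using M.pair_conf_short_reach 3 assms rq by (simp add: add.commute)
    next
      case c: 3
      then show ?thesis using pair_conf_clique_pred 3 m_def rq by simp
    qed
  qed
qed

section \<open>Colouring round the circle\<close>

lemma range_periodic:
  fixes f :: "int \<Rightarrow> 'a" and n :: int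
  assumes f_eq: "\<And>i j. f i = f j \<longleftrightarrow> n dvd i - j" and n: "0 < n"
  shows "range f = f ` {p..p + n - 1}"
proof -
  have "f i \<in> f ` {p..p + n - 1}" for i
  proof
    have "n dvd (i - p) - (i - p) mod n" by (rule dvd_minus_mod)
    then show "f i = f (p + (i - p) mod n)" unfolding f_eq by (simp only: diff_diff_eq)
    show "p + (i - p) mod n \<in> {p..p + n - 1}"
      using n pos_mod_bound[of n "i - p"] pos_mod_sign[of n "i - p"] by auto
  qed
  then show ?thesis by auto
qed

text \<open>\<open>f\<close> winds the integers round the circle with period \<open>n\<close>, so
  that left, right and intervals make sense although the vertices are only ordered
  cyclically.\<close>

locale circle_graph = list_graph V adj L k
  for V :: "'a set" and adj and L :: "'a \<Rightarrow> 'c set" and k +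
  fixes n :: int and f :: "int \<Rightarrow> 'a" and r l :: "int \<Rightarrow> int"
  assumes n: "int k + 4 \<le> n" and k: "8 \<le> k"
    and f_eq: "f i = f j \<longleftrightarrow> n dvd i - j" and V: "V = range f"
    and nbhd: "N (f i) = f ` ({l i..r i} - {i})"
    and wheel: "wheel (int k) r l"
begin

lemma reach: "l i \<le> i" "i \<le> r i" "int k \<le> r i - l i" "r i - l i \<le> int k + 1" "r i - i < int k"
    "i \<le> j \<Longrightarrow> j \<le> r i \<longleftrightarrow> l j \<le> i"
  using wheel unfolding wheel_def by blast+

lemma f_inj: "f i = f j \<Longrightarrow> \<bar>i - j\<bar> < n \<Longrightarrow> i = j"
  using dvd_imp_le_int[of "i - j" n] by (auto simp: f_eq)

lemma fV [simp]: "f i \<in> V"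
  by (simp add: V)

lemma V_range: "V = f ` {p..p + n - 1}"
  unfolding V by (rule range_periodic[OF f_eq]) (use n in simp)

lemma deg: "card (N (f i)) = nat (r i - l i)"
proof -
  have "inj_on f ({l i..r i} - {i})"
    using reach(4)[of i] n by (auto intro!: inj_onI f_inj)
  then have "card (N (f i)) = card ({l i..r i} - {i})" by (simp add: nbhd card_image)
  also have "\<dots> = nat (r i - l i)" using reach(1,2)[of i] by (simp add: card_Diff_subset)
  finally show ?thesis .
qed

lemma deg_le: "v \<in> V \<Longrightarrow> card (N v) \<le> k + 1"
proof -
  assume "v \<in> V"
  then obtain i where "v = f i" using V by auto
  then show ?thesis using reach(4)[of i] by (simp add: deg)
qed

lemma adj_iff: "adj (f i) (f j) \<longleftrightarrow> (\<exists>j'. l i \<le> j' \<and> j' \<le> r i \<and> j' \<noteq> i \<and> f j' = f j)"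
proof -
  have "adj (f i) (f j) \<longleftrightarrow> f j \<in> N (f i)" by (simp add: N_def)
  also have "\<dots> \<longleftrightarrow> (\<exists>j'. l i \<le> j' \<and> j' \<le> r i \<and> j' \<noteq> i \<and> f j' = f j)"
    unfolding nbhd image_iff by (auto simp: eq_commute[of "f j"])
  finally show ?thesis .
qed

lemma in_N: "l i \<le> j \<Longrightarrow> j \<le> r i \<Longrightarrow> j \<noteq> i \<Longrightarrow> f j \<in> N (f i)"
  by (auto simp: nbhd)

text \<open>The consecutive positions \<open>i\<close> and \<open>i + n\<close> of the vertex
  \<open>f i\<close> lie on either side of \<open>{l j..r j}\<close>, so no position of it lies
  inside.\<close>

lemma not_adj:
  assumes "i < l j" "r j < i + n"
  shows "\<not> adj (f i) (f j)"
proof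
  assume "adj (f i) (f j)"
  then have "adj (f j) (f i)" by (rule sym)
  then obtain i' where i': "l j \<le> i'" "i' \<le> r j" "f i' = f i"
    unfolding adj_iff by blast
  then have "i' = i" using assms by (intro f_inj) auto
  then show False using i' assms by simp
qed

text \<open>The order of colouring: first the set \<open>P\<close>, then the remaining positions from \<open>e\<close> down to \<open>p\<close>,
  with \<open>u\<close> and finally \<open>p\<close> last.\<close>

lemma sweep:
  assumes Y: "Y \<subseteq> {p<..r p}" and u: "p < u" "u \<le> r p" "u \<notin> Y" and e: "r p \<le> e" "e < p + n"
    and room: "\<And>j. j > r p \<Longrightarrow> room k r l Y j"
    and P: "P = f ` (Y \<union> {e<..<p + n})" and c: "completes c P {f u, f p}" and col: "colours c P"
  shows "\<exists>c. colours c V"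
proof -
  have notP: "f i \<notin> P" if "p \<le> i" "i \<le> e" "i \<notin> Y" for i
  proof
    assume "f i \<in> P"
    then obtain s where s: "s \<in> Y \<union> {e<..<p + n}" "f i = f s" unfolding P by blast
    moreover have "p < s" "s < p + n" using s(1) Y e that by force+
    ultimately have "i = s" using that e f_inj[of i s] by auto
    then show False using s that by auto
  qed
  let ?T = "\<lambda>j. f ` ({p..j} - Y)"
  have pY: "p \<notin> Y" using Y by auto
  have start: "completes c P (?T (r p))"
  proof -
    \<comment> \<open>\<open>{p..r p}\<close> is a clique, so all its other vertices have
      \<open>u\<close> and \<open>p\<close> as later neighbours.\<close>
    have "completes c P ({f u, f p} \<union> f ` ({p<..r p} - Y - {u}))"
    proof (rule completes_Un[OF c])
      show "f ` ({p<..r p} - Y - {u}) \<inter> P = {}" using notP e by auto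
      fix x assume "x \<in> f ` ({p<..r p} - Y - {u})"
      then obtain j where "j \<in> {p<..r p} - Y - {u}" "x = f j" by blast
      then have j: "p < j" "j \<le> r p" "j \<notin> Y" "j \<noteq> u" "x = f j" by auto
      have "l j \<le> p" using reach(6)[of p j] j by simp
      moreover have "u \<le> r j" using reach(6)[of j "u"] reach(6)[of p "u"] j u reach(2)[of j] by linarith
      ultimately have "f p \<in> N x" "f u \<in> N x" using in_N j u reach(2)[of j] by auto
      moreover have "f p \<noteq> f u" using f_inj[of p u] u reach(5)[of p] n by auto
      ultimately show "\<exists>i j. i \<noteq> j \<and> i \<in> N x \<inter> {f u, f p} \<and> j \<in> N x \<inter> {f u, f p}" by blast
      show "card (N x) \<le> k + 1" using j deg_le by simp
    qed auto
    also have "{f u, f p} \<union> f ` ({p<..r p} - Y - {u}) = ?T (r p)"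
    proof -
      have "{p..r p} - Y = {u, p} \<union> ({p<..r p} - Y - {u})" using u pY reach(2)[of p] by auto
      then show ?thesis by auto
    qed
    finally show ?thesis .
  qed
  have "completes c P (?T j)" if "r p \<le> j" "j \<le> e" for j
    using that
  proof (induction j rule: int_ge_induct)
    case base
    then show ?case using start by simp
  next
    case (step j)
    have T: "completes c P (?T j)" using step by simp
    have j: "j + 1 \<notin> Y" "j + 1 > r p" "p \<le> j + 1" using step Y reach(2)[of p] by auto
    \<comment> \<open>\<open>p\<close> does not reach \<open>j + 1\<close>, so all left neighbours
      of \<open>j + 1\<close> lie in \<open>{p..j}\<close>; those not in \<open>Y\<close> are
      coloured later.\<close>
    have lj: "p < l (j + 1)" using reach(6)[of p "j + 1"] j by linarith
    have nP: "f (j + 1) \<notin> P" using notP[of "j + 1"] step j by simp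
    have ij: "f i \<in> N (f (j + 1)) \<inter> ?T j" if "l (j + 1) \<le> i" "i < j + 1" "i \<notin> Y" for i
      using that lj reach(2)[of "j + 1"] by (auto intro!: in_N)
    from room[OF j(2)] obtain i where i: "l (j + 1) \<le> i" "i < j + 1" "i \<notin> Y"
      "r (j + 1) - l (j + 1) = k \<or> (\<exists>i'. i' \<noteq> i \<and> l (j + 1) \<le> i' \<and> i' < j + 1 \<and> i' \<notin> Y)"
      unfolding room_def by blast
    from i(4) have "completes c P (insert (f (j + 1)) (?T j))"
    proof
      assume "r (j + 1) - l (j + 1) = k"
      then show ?thesis using ij[OF i(1-3)] nP T
        by (intro completes_insert_card[where S = "{f i}"]) (auto simp: deg)
    next
      assume "\<exists>i'. i' \<noteq> i \<and> l (j + 1) \<le> i' \<and> i' < j + 1 \<and> i' \<notin> Y"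
      then obtain i' where i': "i' \<noteq> i" "l (j + 1) \<le> i'" "i' < j + 1" "i' \<notin> Y" by blast
      have "\<bar>i - i'\<bar> < n" using i(1,2) i'(2,3) reach(2)[of "j + 1"] reach(4)[of "j + 1"] n by linarith
      then have "f i \<noteq> f i'" using f_inj[of i i'] i'(1) by blast
      then have "card (N (f (j + 1))) < k + card {f i, f i'}" using deg_le[OF fV, of "j + 1"] by simp
      then show ?thesis using ij[OF i(1-3)] ij[OF i'(2-4)] nP T
        by (intro completes_insert_card[where S = "{f i, f i'}"]) auto
    qed
    also have "insert (f (j + 1)) (?T j) = ?T (j + 1)"
    proof -
      have "{p..j + 1} - Y = insert (j + 1) ({p..j} - Y)" using j by auto
      then show ?thesis by simp
    qed
    finally show ?case .
  qed
  then have "completes c P (?T e)" using e by simp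
  also have "?T e = V - P"
  proof
    show "?T e \<subseteq> V - P" using notP by auto
    have "{p..p + n - 1} \<subseteq> ({p..e} - Y) \<union> (Y \<union> {e<..<p + n})" by auto
    then show "V - P \<subseteq> ?T e" unfolding V_range[of p] P by blast
  qed
  finally have "completes c P (V - P)" .
  moreover have "P \<subseteq> V" using P by auto
  ultimately show ?thesis using completes_all col by blast
qed

lemma f_shift: "f (i + n) = f i"
  by (simp add: f_eq)

lemma reach_right:
  assumes "p < y" "y \<le> r p"
  shows "l y \<le> p" "r y \<le> p + k + 1"
  using assms reach(6)[of p y] reach(4)[of y] by linarith+

lemma adj_f: "l i \<le> j \<Longrightarrow> j \<le> r i \<Longrightarrow> j \<noteq> i \<Longrightarrow> adj (f i) (f j)"
  using in_N by (auto simp: N_def)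

lemma colourable_single_pair:
  assumes "single_pair_conf k r l p y u"
  shows "\<exists>c. colours c V"
proof -
  note a = assms[unfolded single_pair_conf_def]
  have y: "p - 1 < l y" "l y \<le> p" "r y \<le> p + k + 1"
    using a reach_right[of p y] reach(6)[of "p - 1" y] by linarith+
  have na: "\<not> adj (f (p - 1)) (f y)" by (rule not_adj) (use y n in auto)
  have u: "l u \<le> p" "r u \<ge> y"
    using a reach_right[of p u] reach(6)[of u y] y reach(2)[of u] by linarith+
  obtain c where c: "colours c {f (p - 1), f y}" "completes c {f (p - 1), f y} {f u, f p}"
  proof (rule completes_one_pair[of "f (p - 1)" "f y" "f u" "f p"])
    show "f (p - 1) \<noteq> f y" "f u \<noteq> f (p - 1)" "f u \<noteq> f y"
      using a y n reach(5)[of p] by (auto dest!: f_inj)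
    show "\<not> adj (f (p - 1)) (f y)" by (rule na)
    show "adj (f p) (f (p - 1))" "adj (f p) (f y)" "adj (f p) (f u)"
      using a reach(2)[of p] by (auto intro!: adj_f)
    show "card (N (f p)) \<le> k" using a by (simp add: deg)
    show "card (N (f u)) \<le> k + 1" by (rule deg_le[OF fV])
    show "card (N (f u)) \<le> k \<or> adj (f u) (f (p - 1)) \<and> adj (f u) (f y)"
      using a u by (auto simp: deg intro!: adj_f)
  qed (use k in auto)
  \<comment> \<open>One turn later, \<open>p - 1\<close> is the last position before
    \<open>p + n\<close>; the sweep therefore starts at \<open>e = p + n - 2\<close>.\<close>
  have P: "{f (p - 1), f y} = f ` ({y} \<union> {p + n - 2<..<p + n})"
  proof -
    have "{p + n - 2<..<p + n} = {(p - 1) + n}" by auto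
    then show ?thesis by (simp only: image_Un image_insert image_empty f_shift) auto
  qed
  show ?thesis
    by (rule sweep[where Y = "{y}" and e = "p + n - 2", OF _ _ _ _ _ _ _ P c(2,1)])
      (use a n reach(5)[of p] in auto)
qed

lemma colourable_double_pair:
  assumes "double_pair_conf k r l p y y' u"
  shows "\<exists>c. colours c V"
proof -
  note a = assms[unfolded double_pair_conf_def]
  have y: "p - 1 < l y" "l y \<le> p" "r y \<le> p + k + 1" "p - 2 < l y'" "l y' \<le> p" "r y' \<le> p + k + 1"
    using a reach_right[of p y] reach_right[of p y'] reach(6)[of "p - 1" y] reach(6)[of "p - 2" y'] by linarith+
  have na: "\<not> adj (f (p - 1)) (f y)" by (rule not_adj) (use y n in auto)
  \<comment> \<open>\<open>y'\<close> reaches at most \<open>p + k + 1\<close>, below the next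
    position \<open>p - 2 + n\<close> of the vertex at \<open>p - 2\<close>; this is where
    \<open>int k + 4 \<le> n\<close> enters.\<close>
  have na': "\<not> adj (f (p - 2)) (f y')" by (rule not_adj) (use y n in auto)
  have u: "l u \<le> p" "r u \<ge> y"
    using a reach_right[of p u] reach(6)[of u y] y reach(2)[of u] by linarith+
  let ?P = "{f (p - 1), f y, f (p - 2), f y'}"
  obtain c where c: "colours c ?P" "completes c ?P {f u, f p}"
  proof (rule completes_two_pairs[of "f (p - 1)" "f y" "f (p - 2)" "f y'" "f u" "f p"])
    show "f (p - 1) \<noteq> f y" "f (p - 2) \<noteq> f y'" "{f (p - 1), f y} \<inter> {f (p - 2), f y'} = {}"
       "f u \<notin> ?P" using a y n reach(5)[of p] by (auto dest!: f_inj)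
    show "\<not> adj (f (p - 1)) (f y)" "\<not> adj (f (p - 2)) (f y')" by (rule na na')+
    show "adj (f p) (f (p - 1))" "adj (f p) (f y)" "adj (f p) (f u)"
      "adj (f p) (f (p - 2))" "adj (f p) (f y')"
      using a reach(2)[of p] by (auto intro!: adj_f)
    show "card (N (f p)) \<le> k + 1" "card (N (f u)) \<le> k + 1" by (rule deg_le[OF fV])+
    show "card (N (f u)) \<le> k \<or> adj (f u) (f (p - 1)) \<and> adj (f u) (f y)"
      using a u by (auto simp: deg intro!: adj_f)
  qed (use k in auto)
  have P: "?P = f ` ({y, y'} \<union> {p + n - 3<..<p + n})"
  proof -
    have "{p + n - 3<..<p + n} = {(p - 1) + n, (p - 2) + n}" by auto
    then show ?thesis by (simp only: image_Un image_insert image_empty f_shift) auto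
  qed
  show ?thesis
    by (rule sweep[where Y = "{y, y'}" and e = "p + n - 3", OF _ _ _ _ _ _ _ P c(2,1)])
      (use a n reach(5)[of p] in auto)
qed

lemma colourable_pair_conf: "pair_conf k r l \<Longrightarrow> \<exists>c. colours c V"
  using colourable_single_pair colourable_double_pair by (auto simp: pair_conf_def)

lemma reflect: "circle_graph V adj L k n (\<lambda>i. f (- i)) (\<lambda>i. - l (- i)) (\<lambda>i. - r (- i))"
proof
  show "f (- i) = f (- j) \<longleftrightarrow> n dvd i - j" for i j by (simp add: f_eq dvd_diff_commute)
  have "range (\<lambda>i. f (- i)) = f ` range uminus" by (simp only: image_image)
  then show "V = range (\<lambda>i. f (- i))" using V by simp
  show "N (f (- i)) = (\<lambda>i. f (- i)) ` ({- r (- i)..- l (- i)} - {i})" for i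
  proof -
    have "{l (- i)..r (- i)} - {- i} = uminus ` ({- r (- i)..- l (- i)} - {i})"
      by (simp add: image_set_diff)
    then show ?thesis by (simp add: nbhd image_image)
  qed
  show "wheel (int k) (\<lambda>i. - l (- i)) (\<lambda>i. - r (- i))" by (rule wheel_reflect[OF wheel])
qed (use n k in auto)

lemma colourable: "\<exists>c. colours c V"
  using wheel_has_pair_conf[OF wheel] k colourable_pair_conf circle_graph.colourable_pair_conf[OF reflect] by auto

end

section \<open>Arcs of a circle\<close>

text \<open>The vertex \<open>v\<close> is the point of the circle with angle \<open>t v\<close>, and \<open>(a, b)\<close> stands for the arc of
  the angles from \<open>a\<close> to \<open>b\<close>.\<close>

definition arc_adj :: "('a \<Rightarrow> real) \<Rightarrow> (real \<times> real) set \<Rightarrow> 'a \<Rightarrow> 'a \<Rightarrow> bool" where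
  "arc_adj t F u v \<longleftrightarrow> u \<noteq> v \<and> (\<exists>(a, b)\<in>F. (\<exists>s. t u + 2 * pi * of_int s \<in> {a..b}) \<and>
     (\<exists>s. t v + 2 * pi * of_int s \<in> {a..b}))"

locale arcs =
  fixes V :: "'a set" and t :: "'a \<Rightarrow> real" and F :: "(real \<times> real) set"
  assumes fin: "finite V" and ne: "V \<noteq> {}" and inj: "inj_on t V"
    and t: "v \<in> V \<Longrightarrow> 0 \<le> t v \<and> t v < 2 * pi"
    and F: "(a, b) \<in> F \<Longrightarrow> b < a + 2 * pi"
begin

definition n :: int where "n = int (card V)"

text \<open>The vertices by increasing angle, repeated with period \<open>n\<close>.\<close>

definition f :: "int \<Rightarrow> 'a" where
  "f i = inv_into V t (sorted_list_of_set (t ` V) ! nat (i mod n))"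

text \<open>The angle lifted to the real line: it increases strictly with the position and grows by
  \<open>2 * pi\<close> in each turn of \<open>n\<close> steps.\<close>

definition \<theta> :: "int \<Rightarrow> real" where "\<theta> i = t (f i) + 2 * pi * of_int (i div n)"

lemma n_pos: "0 < n"
  using fin ne by (simp add: n_def card_gt_0_iff)

lemma mod_n: "0 \<le> i mod n" "i mod n < n"
  using n_pos by auto

lemma nat_less_n: "nat (i mod n) < nat n"
  using nat_less_eq_zless[OF mod_n(1)] mod_n(2) by blast

lemma len: "length (sorted_list_of_set (t ` V)) = nat n"
  using inj fin by (simp add: n_def card_image)

lemma nth_t: "sorted_list_of_set (t ` V) ! nat (i mod n) \<in> t ` V"
  using nth_mem[of "nat (i mod n)" "sorted_list_of_set (t ` V)"] nat_less_n[of i] fin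
  unfolding len by (simp only: set_sorted_list_of_set finite_imageI)

lemma tf: "t (f i) = sorted_list_of_set (t ` V) ! nat (i mod n)"
  unfolding f_def by (rule f_inv_into_f[OF nth_t])

lemma fV: "f i \<in> V"
  unfolding f_def by (rule inv_into_into[OF nth_t])

lemma tf_less: "i mod n < j mod n \<Longrightarrow> t (f i) < t (f j)"
  unfolding tf using mod_n[of j] mod_n[of i] n_pos
  by (intro sorted_wrt_nth_less[OF strict_sorted_list_of_set]) (simp_all only: len nat_less_eq_zless)

lemma f_eq: "f i = f j \<longleftrightarrow> n dvd i - j"
proof -
  have "f i = f j \<longleftrightarrow> i mod n = j mod n"
  proof
    assume "f i = f j"
    then show "i mod n = j mod n" using tf_less[of i j] tf_less[of j i]
      by (cases "i mod n" "j mod n" rule: linorder_cases) auto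
  qed (simp add: f_def)
  then show ?thesis by (simp add: mod_eq_dvd_iff)
qed

lemma V_eq: "V = range f"
proof
  show "V \<subseteq> range f"
  proof
    fix v assume v: "v \<in> V"
    then have "t v \<in> set (sorted_list_of_set (t ` V))" using fin by simp
    then obtain m where m: "m < nat n" "sorted_list_of_set (t ` V) ! m = t v"
      using len by (metis in_set_conv_nth)
    then have "int m mod n = int m" by simp
    then have "f (int m) = v" using m v inj by (simp add: f_def)
    then show "v \<in> range f" by blast
  qed
qed (use fV in auto)

lemma theta_mono: "i < j \<Longrightarrow> \<theta> i < \<theta> j"
proof -
  assume ij: "i < j"
  have le: "i div n \<le> j div n" using ij n_pos by (simp add: zdiv_mono1)
  show ?thesis
  proof (cases "i div n = j div n")
    case True
    then have "i mod n < j mod n"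
      using ij unfolding minus_mult_div_eq_mod[symmetric] by simp
    then show ?thesis using tf_less True by (simp add: \<theta>_def)
  next
    case False
    then have "i div n + 1 \<le> j div n" using le by linarith
    then have "real_of_int (i div n) + 1 \<le> of_int (j div n)" by linarith
    then have "2 * pi * (real_of_int (i div n) + 1) \<le> 2 * pi * of_int (j div n)"
      by (intro mult_left_mono) auto
    then show ?thesis using t[OF fV, of i] t[OF fV, of j] by (simp add: \<theta>_def algebra_simps)
  qed
qed

lemma theta_less_iff: "\<theta> i < \<theta> j \<longleftrightarrow> i < j"
  using theta_mono[of i j] theta_mono[of j i] by (cases i j rule: linorder_cases) auto

lemma theta_shift: "\<theta> (i + n) = \<theta> i + 2 * pi"
proof -
  have "f (i + n) = f i" by (simp add: f_eq)
  moreover have "(i + n) div n = i div n + 1" using n_pos by simp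
  ultimately show ?thesis by (simp add: \<theta>_def algebra_simps)
qed

lemma lift:
  assumes "v \<in> V"
  obtains j where "f j = v" "\<theta> j = t v + 2 * pi * of_int q"
proof -
  obtain i where i: "v = f i" using assms V_eq by auto
  let ?j = "i mod n + q * n"
  have "n dvd ?j - i"
    unfolding minus_mult_div_eq_mod[symmetric] by simp
  then have "f ?j = v" by (simp only: i f_eq)
  moreover have "?j div n = q" using n_pos mod_n[of i] by simp
  ultimately show ?thesis using that[of ?j] by (simp add: \<theta>_def)
qed

text \<open>\<open>linked i j\<close> is meant for \<open>i \<le> j\<close>: some arc contains all points from \<open>i\<close> to \<open>j\<close>.\<close>

definition linked :: "int \<Rightarrow> int \<Rightarrow> bool" where
  "linked i j \<longleftrightarrow> i = j \<or> (\<exists>(a, b)\<in>F. \<exists>s. a \<le> \<theta> i + 2 * pi * of_int s \<and> \<theta> j + 2 * pi * of_int s \<le> b)"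

lemma linkedI:
  "(a, b) \<in> F \<Longrightarrow> a \<le> \<theta> i + 2 * pi * of_int s \<Longrightarrow> \<theta> j + 2 * pi * of_int s \<le> b \<Longrightarrow> linked i j"
  unfolding linked_def by blast

text \<open>An arc is shorter than the whole circle, so it cannot contain two lifts of the same
  point.\<close>

lemma linked_less:
  assumes "linked i j"
  shows "j < i + n"
proof (cases "i = j")
  case False
  then obtain a b s where "(a, b) \<in> F" "a \<le> \<theta> i + 2 * pi * of_int s" "\<theta> j + 2 * pi * of_int s \<le> b"
    using assms by (auto simp: linked_def)
  then have "\<theta> j < \<theta> (i + n)" using F[of a b] by (simp add: theta_shift)
  then show ?thesis by (simp add: theta_less_iff)
qed (use n_pos in simp)

lemma linked_mono:
  assumes "linked i j" "i \<le> i'" "i' \<le> j'" "j' \<le> j"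
  shows "linked i' j'"
proof (cases "i = j")
  case False
  then obtain a b s where s: "(a, b) \<in> F" "a \<le> \<theta> i + 2 * pi * of_int s" "\<theta> j + 2 * pi * of_int s \<le> b"
    using assms by (auto simp: linked_def)
  have "\<theta> i \<le> \<theta> i'" "\<theta> j' \<le> \<theta> j" using assms theta_less_iff[of i' i] theta_less_iff[of j j'] by linarith+
  then show ?thesis using s by (intro linkedI[of a b _ s]) linarith+
qed (use assms in \<open>auto simp: linked_def\<close>)

definition r :: "int \<Rightarrow> int" where "r i = Max {j. i \<le> j \<and> linked i j}"
definition l :: "int \<Rightarrow> int" where "l j = Min {i. i \<le> j \<and> linked i j}"

lemma r:
  shows "i \<le> r i" "i \<le> j \<Longrightarrow> j \<le> r i \<longleftrightarrow> linked i j" "r i < i + n"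
proof -
  let ?S = "{j. i \<le> j \<and> linked i j}"
  have fS: "finite ?S" by (rule finite_subset[of _ "{i..i + n}"]) (use linked_less[of i] in force)+
  have iS: "i \<in> ?S" by (simp add: linked_def)
  then have in_S: "r i \<in> ?S" unfolding r_def using fS Max_in by blast
  then show "i \<le> r i" "r i < i + n" using linked_less by auto
  assume "i \<le> j"
  show "j \<le> r i \<longleftrightarrow> linked i j"
  proof
    assume "j \<le> r i"
    then show "linked i j" using in_S linked_mono \<open>i \<le> j\<close> by blast
  next
    assume "linked i j"
    then show "j \<le> r i" unfolding r_def using fS \<open>i \<le> j\<close> by (intro Max_ge) auto
  qed
qed

lemma l:
  shows "l j \<le> j" "i \<le> j \<Longrightarrow> l j \<le> i \<longleftrightarrow> linked i j" "j < l j + n"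
proof -
  let ?S = "{i. i \<le> j \<and> linked i j}"
  have fS: "finite ?S" by (rule finite_subset[of _ "{j - n..j}"]) (use linked_less[of _ j] in force)+
  have iS: "j \<in> ?S" by (simp add: linked_def)
  then have in_S: "l j \<in> ?S" unfolding l_def using fS Min_in by blast
  then show "l j \<le> j" "j < l j + n" using linked_less by auto
  assume "i \<le> j"
  show "l j \<le> i \<longleftrightarrow> linked i j"
  proof
    assume "l j \<le> i"
    then show "linked i j" using in_S linked_mono \<open>i \<le> j\<close> by blast
  next
    assume "linked i j"
    then show "l j \<le> i" unfolding l_def using fS \<open>i \<le> j\<close> by (intro Min_le) auto
  qed
qed

lemma f_inj: "f i = f j \<Longrightarrow> \<bar>i - j\<bar> < n \<Longrightarrow> i = j"
  using dvd_imp_le_int[of "i - j" n] by (auto simp: f_eq)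

lemma linked_adj:
  assumes "linked i j" "i < j"
  shows "arc_adj t F (f i) (f j)"
proof -
  obtain a b s where s: "(a, b) \<in> F" "a \<le> \<theta> i + 2 * pi * of_int s" "\<theta> j + 2 * pi * of_int s \<le> b"
    using assms by (auto simp: linked_def)
  have e: "\<theta> i + 2 * pi * of_int s = t (f i) + 2 * pi * of_int (i div n + s)" for i
    by (simp add: \<theta>_def algebra_simps)
  have "\<theta> i < \<theta> j" using assms theta_less_iff by simp
  then have "t (f i) + 2 * pi * of_int (i div n + s) \<in> {a..b}" "t (f j) + 2 * pi * of_int (j div n + s) \<in> {a..b}"
    using s unfolding e[symmetric] by auto
  moreover have "f i \<noteq> f j" using f_inj[of i j] assms linked_less[of i j] by auto
  ultimately show ?thesis unfolding arc_adj_def using s(1) by blast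
qed

lemma arc_adj_sym: "arc_adj t F u v \<Longrightarrow> arc_adj t F v u"
  unfolding arc_adj_def by blast

lemma nbhd: "{w \<in> V. arc_adj t F (f i) w} = f ` ({l i..r i} - {i})"
proof
  show "f ` ({l i..r i} - {i}) \<subseteq> {w \<in> V. arc_adj t F (f i) w}"
  proof clarsimp
    fix j assume j: "l i \<le> j" "j \<le> r i" "j \<noteq> i"
    then have "i < j \<and> linked i j \<or> j < i \<and> linked j i"
      using l(2)[of j i] r(2)[of i j] by linarith
    then show "f j \<in> V \<and> arc_adj t F (f i) (f j)"
      using linked_adj arc_adj_sym fV by blast
  qed
next
  show "{w \<in> V. arc_adj t F (f i) w} \<subseteq> f ` ({l i..r i} - {i})"
  proof clarify
    fix w assume w: "w \<in> V" "arc_adj t F (f i) w"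
    then obtain a b s s' where ab: "(a, b) \<in> F" "t (f i) + 2 * pi * of_int s \<in> {a..b}"
      "t w + 2 * pi * of_int s' \<in> {a..b}" "f i \<noteq> w"
      unfolding arc_adj_def by blast
    define s0 where "s0 = s - i div n"
    have ti: "\<theta> i + 2 * pi * of_int s0 = t (f i) + 2 * pi * of_int s"
      by (simp add: \<theta>_def s0_def algebra_simps)
    obtain j where j: "f j = w" "\<theta> j = t w + 2 * pi * of_int (s' - s0)"
      using lift w by blast
    have tj: "\<theta> j + 2 * pi * of_int s0 = t w + 2 * pi * of_int s'"
      by (simp add: j algebra_simps)
    \<comment> \<open>Both points lie in the same lifted arc, so both statements hold whatever the
      order of \<open>i\<close> and \<open>j\<close>; the correctly ordered one bounds the
      reach.\<close>
    have "linked i j" "linked j i"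
      using ab ti tj by (auto intro!: linkedI[of a b _ s0])
    then have "l i \<le> j" "j \<le> r i"
      using l(1)[of i] r(1)[of i] l(2)[of j i] r(2)[of i j] by linarith+
    moreover have "j \<noteq> i" using j ab by auto
    ultimately show "w \<in> f ` ({l i..r i} - {i})" using j by auto
  qed
qed

lemma colourable_critical:
  fixes L :: "'a \<Rightarrow> 'c set"
  assumes k: "8 \<le> k" and L: "\<And>v. v \<in> V \<Longrightarrow> finite (L v) \<and> card (L v) = k"
    and deg: "\<And>v. v \<in> V \<Longrightarrow> k \<le> card {w \<in> V. arc_adj t F v w} \<and> card {w \<in> V. arc_adj t F v w} \<le> k + 1"
    and clique: "\<And>S. S \<subseteq> V \<Longrightarrow> card S = k + 1 \<Longrightarrow> \<exists>x\<in>S. \<exists>y\<in>S. x \<noteq> y \<and> \<not> arc_adj t F x y"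
  shows "\<exists>c. (\<forall>v\<in>V. c v \<in> L v) \<and> (\<forall>u\<in>V. \<forall>v\<in>V. arc_adj t F u v \<longrightarrow> c u \<noteq> c v)"
proof -
  interpret G: list_graph V "arc_adj t F" L k
  proof
    show "\<not> arc_adj t F v v" for v by (simp add: arc_adj_def)
  qed (use fin arc_adj_sym L in blast)+
  have N: "G.N v = {w \<in> V. arc_adj t F v w}" for v by (simp add: G.N_def)
  have "\<exists>c. G.colours c V"
  proof (cases "card V \<le> k + 3")
    case True
    then show ?thesis by (intro G.dense_colourable[OF k]) (use ne deg clique N in auto)
  next
    case False
    then have nk: "int k + 4 \<le> n" by (simp add: n_def)
    have w: "l i \<le> i \<and> i \<le> r i \<and> int k \<le> r i - l i \<and> r i - l i \<le> int k + 1 \<and> r i - i < int k" for i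
    proof -
      have li: "l i \<le> i" "i \<le> r i" using l(1) r(1) by auto
      have d: "k \<le> card (f ` ({l i..r i} - {i}))" "card (f ` ({l i..r i} - {i})) \<le> k + 1"
        using deg[OF fV, of i] nbhd[of i] by auto
      \<comment> \<open>A window of \<open>n\<close> positions would contain every vertex and force
        degree \<open>card V - 1\<close>, which exceeds \<open>k + 1\<close>.\<close>
      have short: "r i - l i < n - 1"
      proof (rule ccontr)
        assume "\<not> ?thesis"
        then have "f ` {l i..l i + n - 1} \<subseteq> insert (f i) (f ` ({l i..r i} - {i}))" by auto
        moreover have "V = f ` {l i..l i + n - 1}"
          by (rule trans[OF V_eq range_periodic[OF f_eq n_pos]])
        ultimately have "V \<subseteq> insert (f i) (f ` ({l i..r i} - {i}))" by (simp only:)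
        then have "card V \<le> card (insert (f i) (f ` ({l i..r i} - {i})))" by (intro card_mono) auto
        also have "\<dots> \<le> Suc (card (f ` ({l i..r i} - {i})))" by (rule card_insert_le_m1) auto
        finally show False using d False by simp
      qed
      have "inj_on f ({l i..r i} - {i})" using short by (intro inj_onI f_inj) auto
      then have "card (f ` ({l i..r i} - {i})) = nat (r i - l i)"
        using li by (simp add: card_image card_Diff_subset)
      \<comment> \<open>Otherwise \<open>i\<close> and \<open>i + int k\<close> are linked, which
        makes the \<open>k + 1\<close> vertices from one to the other a clique.\<close>
      moreover have "r i - i < int k"
      proof (rule ccontr)
        assume c: "\<not> ?thesis"
        have "inj_on f {i..i + int k}" using nk by (intro inj_onI f_inj) auto
        then have "card (f ` {i..i + int k}) = k + 1" by (simp add: card_image)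
        then obtain x y where xy: "x \<in> {i..i + int k}" "y \<in> {i..i + int k}" "f x \<noteq> f y"
          "\<not> arc_adj t F (f x) (f y)"
          using clique[of "f ` {i..i + int k}"] fV by blast
        have "linked i (i + int k)" using r(2)[of i "i + int k"] c by simp
        then have "x < y \<Longrightarrow> linked x y" "y < x \<Longrightarrow> linked y x"
          using xy(1,2) by (auto elim: linked_mono)
        moreover have "x \<noteq> y" using xy by auto
        ultimately show False using xy(4) linked_adj[of x y] linked_adj[of y x] arc_adj_sym
          by (meson linorder_neqE)
      qed
      ultimately show ?thesis using d li by auto
    qed
    interpret circle_graph V "arc_adj t F" L k n f r l
    proof
      show "int k + 4 \<le> n" by (rule nk)
      show "8 \<le> k" by (rule k)
      show "f i = f j \<longleftrightarrow> n dvd i - j" for i j by (rule f_eq)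
      show "V = range f" by (rule V_eq)
      show "G.N (f i) = f ` ({l i..r i} - {i})" for i unfolding N by (rule nbhd)
      show "wheel (int k) r l" using w r(2) l(2) by (auto simp: wheel_def)
    qed
    show ?thesis by (rule colourable)
  qed
  then show ?thesis by (simp add: G.colours_def)
qed

end

section \<open>Reduction to graphs with all degrees \<open>k\<close> or \<open>k + 1\<close>\<close>

text \<open>A vertex of degree below \<open>k\<close> can be coloured last, and deleting it keeps
  \<open>t\<close>, \<open>F\<close> and the hypotheses. Without such vertices the graph is one of
  those coloured by going round the circle or by density.\<close>

lemma arc_list_colouring:
  fixes L :: "'a \<Rightarrow> 'c set" and k :: nat
  assumes V: "finite V" "inj_on t V" and t: "\<And>v. v \<in> V \<Longrightarrow> 0 \<le> t v \<and> t v < 2 * pi"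
    and F: "\<And>a b. (a, b) \<in> F \<Longrightarrow> b < a + 2 * pi" and k: "8 \<le> k"
    and L: "\<And>v. v \<in> V \<Longrightarrow> finite (L v) \<and> card (L v) = k"
    and deg: "\<And>v. v \<in> V \<Longrightarrow> card {w \<in> V. arc_adj t F v w} \<le> k + 1"
    and clique: "\<And>S. S \<subseteq> V \<Longrightarrow> card S = k + 1 \<Longrightarrow> \<exists>x\<in>S. \<exists>y\<in>S. x \<noteq> y \<and> \<not> arc_adj t F x y"
  shows "\<exists>c. (\<forall>v\<in>V. c v \<in> L v) \<and> (\<forall>u\<in>V. \<forall>v\<in>V. arc_adj t F u v \<longrightarrow> c u \<noteq> c v)"
  using assms
proof (induction V rule: finite_psubset_induct)
  case (psubset V)
  show ?case
  proof (cases "\<exists>v\<in>V. card {w \<in> V. arc_adj t F v w} < k")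
    case True
    then obtain v where v: "v \<in> V" "card {w \<in> V. arc_adj t F v w} < k" by blast
    have sub: "V - {v} \<subset> V" using v by blast
    have "\<exists>c. (\<forall>v\<in>V - {v}. c v \<in> L v) \<and>
        (\<forall>x\<in>V - {v}. \<forall>y\<in>V - {v}. arc_adj t F x y \<longrightarrow> c x \<noteq> c y)"
    proof (rule psubset.IH[OF sub _ _ F k])
      show "inj_on t (V - {v})" using psubset.prems(1) by (rule inj_on_diff)
      show "card {w \<in> V - {v}. arc_adj t F x w} \<le> k + 1" if "x \<in> V - {v}" for x
      proof -
        have "card {w \<in> V - {v}. arc_adj t F x w} \<le> card {w \<in> V. arc_adj t F x w}"
          using psubset.hyps by (intro card_mono) auto
        then show ?thesis using psubset.prems(6)[of x] that by simp
      qed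
      show "\<exists>x\<in>S. \<exists>y\<in>S. x \<noteq> y \<and> \<not> arc_adj t F x y" if "S \<subseteq> V - {v}" "card S = k + 1" for S
        using psubset.prems(7)[of S] that by blast
    qed (use psubset.prems(2,5) in auto)
    then obtain c where c: "\<And>x. x \<in> V - {v} \<Longrightarrow> c x \<in> L x"
      "\<And>x y. x \<in> V - {v} \<Longrightarrow> y \<in> V - {v} \<Longrightarrow> arc_adj t F x y \<Longrightarrow> c x \<noteq> c y" by blast
    let ?N = "{w \<in> V. arc_adj t F v w}"
    have "card (c ` ?N) < card (L v)"
      using v psubset.prems(5)[OF v(1)] psubset.hyps card_image_le[of ?N c] by simp
    then have "\<not> L v \<subseteq> c ` ?N" using psubset.hyps card_mono[of "c ` ?N" "L v"] by auto
    then obtain a where a: "a \<in> L v" "a \<notin> c ` ?N" by blast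
    have sym: "arc_adj t F x y \<Longrightarrow> arc_adj t F y x" for x y unfolding arc_adj_def by blast
    have irrefl: "\<not> arc_adj t F x x" for x by (simp add: arc_adj_def)
    have "(c(v := a)) x \<noteq> (c(v := a)) y" if "x \<in> V" "y \<in> V" "arc_adj t F x y" for x y
      using that a c(2)[of x y] sym[OF that(3)] irrefl by auto
    moreover have "(c(v := a)) x \<in> L x" if "x \<in> V" for x using that a c(1)[of x] by auto
    ultimately show ?thesis by blast
  next
    case False
    show ?thesis
    proof (cases "V = {}")
      case ne: False
      interpret arcs V t F
        by unfold_locales (use psubset.hyps psubset.prems(1-3) ne in blast)+
      show ?thesis
        by (rule colourable_critical[OF k])
          (use False psubset.prems in \<open>auto simp: not_less\<close>)
    qed simp
  qed
qed

section \<open>From points on the complex unit circle to angles\<close>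

lemma circle_angle:
  assumes "norm z = 1"
  obtains s where "0 \<le> s" "s < 2 * pi" "cis s = z"
proof -
  have "(Re z)\<^sup>2 + (Im z)\<^sup>2 = 1" using assms by (simp add: cmod_def)
  then obtain s where "0 \<le> s" "s < 2 * pi" "Re z = cos s" "Im z = sin s"
    by (rule sincos_total_2pi)
  then show ?thesis using that[of s] by (simp add: complex_eq_iff)
qed

lemma cis_mem_iff: "cis x \<in> cis ` A \<longleftrightarrow> (\<exists>s. x + 2 * pi * of_int s \<in> A)"
proof
  assume "cis x \<in> cis ` A"
  then obtain y where "y \<in> A" "cis y = cis x" by force
  then have "\<exists>s. y = x + 2 * pi * of_int s"
    using sin_cos_eq_iff[of y x] by (auto simp: complex_eq_iff algebra_simps)
  then show "\<exists>s. x + 2 * pi * of_int s \<in> A" using \<open>y \<in> A\<close> by blast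
next
  assume "\<exists>s. x + 2 * pi * of_int s \<in> A"
  then obtain s where s: "x + 2 * pi * of_int s \<in> A" by blast
  have "cis (x + 2 * pi * of_int s) = cis x"
    using sin_cos_eq_iff[of "x + 2 * pi * of_int s" x] by (auto simp: complex_eq_iff algebra_simps)
  then show "cis x \<in> cis ` A" using s by (metis imageI)
qed

lemma circular_interval_arcs:
  assumes "circular_interval_graph V E"
  obtains t F where "inj_on t V" "\<And>v. v \<in> V \<Longrightarrow> 0 \<le> t v \<and> t v < 2 * pi"
    "\<And>a b. (a, b) \<in> F \<Longrightarrow> b < a + 2 * pi"
    "\<And>u v. u \<in> V \<Longrightarrow> v \<in> V \<Longrightarrow> {u, v} \<in> E \<longleftrightarrow> arc_adj t F u v"
proof -
  obtain P C g where P: "P \<subseteq> {z. norm z = 1}" and C: "\<forall>I\<in>C. closed_circle_interval I"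
    and g: "bij_betw g V P" "\<And>u v. u \<in> V \<Longrightarrow> v \<in> V \<Longrightarrow> {u, v} \<in> E \<longleftrightarrow> {g u, g v} \<in> interval_edges P C"
    using assms by (auto simp: circular_interval_graph_def graph_iso_def)
  have gP: "g v \<in> P" if "v \<in> V" for v using g(1) that by (auto simp: bij_betw_def)
  have g_inj: "g u = g v \<longleftrightarrow> u = v" if "u \<in> V" "v \<in> V" for u v
    using g(1) that by (auto simp: bij_betw_def inj_on_def)
  have "\<exists>s. 0 \<le> s \<and> s < 2 * pi \<and> cis s = g v" if "v \<in> V" for v
    using circle_angle[of "g v"] gP[OF that] P by blast
  then obtain t where t: "\<And>v. v \<in> V \<Longrightarrow> 0 \<le> t v \<and> t v < 2 * pi \<and> cis (t v) = g v" by metis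
  \<comment> \<open>An interval determines its end angles only up to full turns, so \<open>F\<close>
    contains all pairs that represent a member of \<open>C\<close>; adjacency does not depend on the
    choice.\<close>
  define F where "F = {(a, b). b < a + 2 * pi \<and> cis ` {a..b} \<in> C}"
  have mem: "g v \<in> cis ` {a..b} \<longleftrightarrow> (\<exists>s. t v + 2 * pi * of_int s \<in> {a..b})" if "v \<in> V" for v a b
    using cis_mem_iff[of "t v" "{a..b}"] t[OF that] by simp
  have "{u, v} \<in> E \<longleftrightarrow> arc_adj t F u v" if uv: "u \<in> V" "v \<in> V" for u v
  proof -
    have "{u, v} \<in> E \<longleftrightarrow> u \<noteq> v \<and> (\<exists>I\<in>C. g u \<in> I \<and> g v \<in> I)"
      using uv gP[of u] gP[of v] g_inj[of u v]
      unfolding g(2)[OF uv] interval_edges_def by (auto simp: doubleton_eq_iff)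
    also have "\<dots> \<longleftrightarrow> u \<noteq> v \<and> (\<exists>(a, b)\<in>F. g u \<in> cis ` {a..b} \<and> g v \<in> cis ` {a..b})"
    proof (intro conj_cong refl iffI)
      assume "\<exists>I\<in>C. g u \<in> I \<and> g v \<in> I"
      then obtain I where I: "I \<in> C" "g u \<in> I" "g v \<in> I" by blast
      then obtain a b where "b < a + 2 * pi" "I = cis ` {a..b}"
        using C unfolding closed_circle_interval_def by blast
      then show "\<exists>(a, b)\<in>F. g u \<in> cis ` {a..b} \<and> g v \<in> cis ` {a..b}"
        using I by (intro bexI[of _ "(a, b)"]) (auto simp: F_def)
    next
      assume "\<exists>(a, b)\<in>F. g u \<in> cis ` {a..b} \<and> g v \<in> cis ` {a..b}"
      then show "\<exists>I\<in>C. g u \<in> I \<and> g v \<in> I" unfolding F_def by blast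
    qed
    also have "\<dots> \<longleftrightarrow> arc_adj t F u v"
      unfolding arc_adj_def mem[OF uv(1)] mem[OF uv(2)] ..
    finally show ?thesis .
  qed
  moreover have "inj_on t V" using t g_inj by (intro inj_onI) metis
  ultimately show ?thesis using that[of t F] t unfolding F_def by blast
qed

section \<open>Degrees in terms of edges and the final contradiction\<close>

lemma degree_eq_card_neighbours:
  assumes "E \<subseteq> [V]\<^bsup>2\<^esup>" "v \<in> V"
  shows "degree E v = card {w \<in> V. {v, w} \<in> E}"
proof -
  have "{e \<in> E. v \<in> e} = (\<lambda>w. {v, w}) ` {w \<in> V. {v, w} \<in> E}"
  proof (intro equalityI subsetI)
    fix e assume e: "e \<in> {e \<in> E. v \<in> e}"
    then have "e \<subseteq> V" "card e = 2" using assms by (auto simp: nsets_def)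
    then obtain x y where "e = {x, y}" by (auto simp: card_2_iff)
    then show "e \<in> (\<lambda>w. {v, w}) ` {w \<in> V. {v, w} \<in> E}"
      using e \<open>e \<subseteq> V\<close> by (auto simp: insert_commute)
  qed auto
  moreover have "inj_on (\<lambda>w. {v, w}) {w \<in> V. {v, w} \<in> E}"
    by (auto simp: inj_on_def doubleton_eq_iff)
  ultimately show ?thesis by (simp add: degree_def card_image)
qed

theorem lemma3p1:
  fixes V :: "'a set" and E :: "'a set set"
  assumes "circular_interval_graph V E"
    and "list_chromatic_number V E \<ge> max_degree V E"
    and "max_degree V E \<ge> 9"
  shows "\<exists>S \<subseteq> V. card S = max_degree V E \<and> [S]\<^bsup>2\<^esup> \<subseteq> E"
proof (rule ccontr)
  assume no_clique: "\<not> ?thesis"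
  define k where "k = max_degree V E - 1"
  have k: "8 \<le> k" "max_degree V E = k + 1" using assms(3) by (simp_all add: k_def)
  have V: "finite V" and E: "E \<subseteq> [V]\<^bsup>2\<^esup>"
    using assms(1) by (auto simp: circular_interval_graph_def finite_simple_graph_def)
  obtain t F where tF: "inj_on t V" "\<And>v. v \<in> V \<Longrightarrow> 0 \<le> t v \<and> t v < 2 * pi"
    "\<And>a b. (a, b) \<in> F \<Longrightarrow> b < a + 2 * pi"
    and adj: "\<And>u v. u \<in> V \<Longrightarrow> v \<in> V \<Longrightarrow> {u, v} \<in> E \<longleftrightarrow> arc_adj t F u v"
    using circular_interval_arcs[OF assms(1)] by blast
  have deg: "card {w \<in> V. arc_adj t F v w} \<le> k + 1" if v: "v \<in> V" for v
  proof -
    have "{w \<in> V. arc_adj t F v w} = {w \<in> V. {v, w} \<in> E}" using adj v by auto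
    then have "card {w \<in> V. arc_adj t F v w} = degree E v"
      using degree_eq_card_neighbours[OF E v] by simp
    also have "\<dots> \<le> max_degree V E"
      unfolding max_degree_def using V v by (intro cSUP_upper) auto
    finally show ?thesis using k by simp
  qed
  have clique: "\<exists>x\<in>S. \<exists>y\<in>S. x \<noteq> y \<and> \<not> arc_adj t F x y" if S: "S \<subseteq> V" "card S = k + 1" for S
  proof -
    obtain e where e: "e \<in> [S]\<^bsup>2\<^esup>" "e \<notin> E" using no_clique S k by auto
    then obtain x y where "e = {x, y}" "x \<noteq> y" "x \<in> S" "y \<in> S"
      by (auto simp: nsets_def card_2_iff)
    then show ?thesis using e adj[of x y] S by blast
  qed
  have "choosable V E k"
    unfolding choosable_def
  proof (intro allI impI)
    fix L :: "'a \<Rightarrow> nat set"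
    assume "\<forall>v\<in>V. finite (L v) \<and> card (L v) = k"
    then have L: "\<And>v. v \<in> V \<Longrightarrow> finite (L v) \<and> card (L v) = k" by blast
    have "\<exists>c. (\<forall>v\<in>V. c v \<in> L v) \<and> (\<forall>u\<in>V. \<forall>v\<in>V. arc_adj t F u v \<longrightarrow> c u \<noteq> c v)"
      by (rule arc_list_colouring[where k = k]) (fact V tF k(1) L deg clique)+
    then obtain c where c: "\<forall>v\<in>V. c v \<in> L v" "\<forall>u\<in>V. \<forall>v\<in>V. arc_adj t F u v \<longrightarrow> c u \<noteq> c v"
      by blast
    have "proper_colouring E c"
      unfolding proper_colouring_def
    proof (intro allI impI)
      fix u v assume uv: "{u, v} \<in> E" "u \<noteq> v"
      then have "u \<in> V" "v \<in> V" using E by (auto simp: nsets_def)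
      then show "c u \<noteq> c v" using c(2) adj[of u v] uv by blast
    qed
    then show "\<exists>c. proper_colouring E c \<and> (\<forall>v\<in>V. c v \<in> L v)" using c(1) by blast
  qed
  then have "list_chromatic_number V E \<le> k"
    unfolding list_chromatic_number_def by (rule Least_le)
  then show False using assms(2) k by simp
qed

end
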